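(* Let $S$ be a finite $p$-group for an odd prime $p$. Let $\mathfrak{X}_1(S)\leq S$ be the subgroup containing $\mathfrak{X}(S)$ such that $\mathfrak{X}_1(S)/\mathfrak{X}(S)=Z(S/\mathfrak{X}(S))$. If $E$ is an elementary abelian $p$-subgroup of $S$ whose rank equals the $p$-rank of $S$ and $E\leq \mathfrak{X}_1(S)$, then $E\leq \mathfrak{X}(S)$.
   Context: For a finite $p$-group $G$ and subgroups $A,B$, write $[A,B;1]=[A,B]$ and $[A,B;k]=[[A,B;k-1],B]$. $\Omega_1(G)$ denotes the subgroup generated by the elements of order $p$ in $G$. The Oliver subgroup $\mathfrak{X}(G)$ of a finite $p$-group $G$ is the unique largest normal subgroup $K$ of $G$ admitting a chain $1=Q_0\leq Q_1\leq\cdots\leq Q_n=K$ of normal subgroups $Q_i\unlhd G$ such that $[\Omega_1(C_G(Q_{i-1})),Q_i;p-1]=1$ for each $1\leq i\leq n$. The $p$-rank of $S$ is the largest rank of an elementary abelian $p$-subgroup of $S$. *)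

theory Defs
  imports "HOL-Algebra.Algebra"
begin

definition commutator :: "('a, 'b) monoid_scheme \<Rightarrow> 'a \<Rightarrow> 'a \<Rightarrow> 'a" where
  "commutator G x y = inv\<^bsub>G\<^esub> x \<otimes>\<^bsub>G\<^esub> inv\<^bsub>G\<^esub> y \<otimes>\<^bsub>G\<^esub> x \<otimes>\<^bsub>G\<^esub> y"

definition comm_subgroup :: "('a, 'b) monoid_scheme \<Rightarrow> 'a set \<Rightarrow> 'a set \<Rightarrow> 'a set" where
  "comm_subgroup G A B = generate G {commutator G a b | a b. a \<in> A \<and> b \<in> B}"

primrec iter_comm :: "('a, 'b) monoid_scheme \<Rightarrow> 'a set \<Rightarrow> 'a set \<Rightarrow> nat \<Rightarrow> 'a set" where
  "iter_comm G A B 0 = A"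
| "iter_comm G A B (Suc k) = comm_subgroup G (iter_comm G A B k) B"

definition Omega1 :: "('a, 'b) monoid_scheme \<Rightarrow> nat \<Rightarrow> 'a set \<Rightarrow> 'a set" where
  "Omega1 G p H = generate G {x \<in> H. group.ord G x = p}"

definition centralizer :: "('a, 'b) monoid_scheme \<Rightarrow> 'a set \<Rightarrow> 'a set" where
  "centralizer G Q = {g \<in> carrier G. \<forall>q \<in> Q. g \<otimes>\<^bsub>G\<^esub> q = q \<otimes>\<^bsub>G\<^esub> g}"

definition center :: "('a, 'b) monoid_scheme \<Rightarrow> 'a set" where
  "center G = centralizer G (carrier G)"

definition p_group :: "('a, 'b) monoid_scheme \<Rightarrow> nat \<Rightarrow> bool" where
  "p_group G p \<longleftrightarrow> group G \<and> Factorial_Ring.prime p \<and> finite (carrier G) \<and> (\<exists>n. card (carrier G) = p ^ n)"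

definition oliver_chain :: "('a, 'b) monoid_scheme \<Rightarrow> nat \<Rightarrow> 'a set \<Rightarrow> bool" where
  "oliver_chain G p K \<longleftrightarrow> (\<exists>(n::nat) (Q :: nat \<Rightarrow> 'a set).
     Q 0 = {\<one>\<^bsub>G\<^esub>} \<and> Q n = K \<and>
     (\<forall>i \<le> n. Q i \<lhd> G) \<and>
     (\<forall>i. 1 \<le> i \<and> i \<le> n \<longrightarrow> Q (i - 1) \<subseteq> Q i) \<and>
     (\<forall>i. 1 \<le> i \<and> i \<le> n \<longrightarrow>
        iter_comm G (Omega1 G p (centralizer G (Q (i - 1)))) (Q i) (p - 1) = {\<one>\<^bsub>G\<^esub>}))"

definition oliver :: "('a, 'b) monoid_scheme \<Rightarrow> nat \<Rightarrow> 'a set" where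
  "oliver G p = (THE K. K \<lhd> G \<and> oliver_chain G p K \<and>
                  (\<forall>K'. K' \<lhd> G \<and> oliver_chain G p K' \<longrightarrow> K' \<subseteq> K))"

definition oliver1 :: "('a, 'b) monoid_scheme \<Rightarrow> nat \<Rightarrow> 'a set" where
  "oliver1 G p = {g \<in> carrier G. oliver G p #>\<^bsub>G\<^esub> g \<in> center (G Mod (oliver G p))}"

definition elementary_abelian :: "('a, 'b) monoid_scheme \<Rightarrow> nat \<Rightarrow> 'a set \<Rightarrow> bool" where
  "elementary_abelian G p E \<longleftrightarrow> subgroup E G \<and>
     (\<forall>x \<in> E. \<forall>y \<in> E. x \<otimes>\<^bsub>G\<^esub> y = y \<otimes>\<^bsub>G\<^esub> x) \<and>
     (\<forall>x \<in> E. x [^]\<^bsub>G\<^esub> p = \<one>\<^bsub>G\<^esub>)"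

definition elab_rank :: "nat \<Rightarrow> 'a set \<Rightarrow> nat" where
  "elab_rank p E = (THE r. card E = p ^ r)"

definition p_rank :: "('a, 'b) monoid_scheme \<Rightarrow> nat \<Rightarrow> nat" where
  "p_rank G p = Max {elab_rank p E | E. elementary_abelian G p E}"

end

theory Submission
  imports Defs
begin

text \<open>
  Write \<open>X\<close> for the Oliver subgroup and \<open>W = \<Omega>\<^sub>1(C(X))\<close>. If \<open>F\<close> is a subgroup that is central modulo
  \<open>X\<close> and \<open>[W, F, F] = 1\<close>, then, as \<open>p - 1 \<ge> 2\<close>, the normal subgroup \<open>X F\<close> extends the chain of \<open>X\<close>, so
  \<open>F \<le> X\<close> by maximality. Applied inside \<open>C(X)\<close> this gives \<open>C(X) \<le> X\<close>, so \<open>W\<close> is elementary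
  abelian and centralized by \<open>X\<close>. With \<open>K = C\<^sub>E(W)\<close> the group \<open>W K\<close> is elementary abelian, hence
  \<open>|W K| \<le> |E|\<close>, which yields \<open>|K| |W| \<le> |E| |C\<^sub>W(E)|\<close>. If \<open>K \<noteq> E\<close>, a replacement argument
  produces \<open>K < F \<le> E\<close> with \<open>[W, F, F] = 1\<close>; then \<open>F \<le> X\<close> centralizes \<open>W\<close>, a contradiction. So \<open>E\<close>
  centralizes \<open>W\<close>, and \<open>E \<le> X\<close>.
\<close>

section \<open>Conjugation and fixed points of p-groups\<close>

text \<open>The right conjugate \<open>x^g\<close>. It is a right action (\<open>cj_cj\<close>), in
  step with \<open>commutator\<close>, for which \<open>[x, y] = x^-1 x^y\<close>.\<close>

definition cj :: "('a, 'b) monoid_scheme \<Rightarrow> 'a \<Rightarrow> 'a \<Rightarrow> 'a" where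
  "cj G g x = inv\<^bsub>G\<^esub> g \<otimes>\<^bsub>G\<^esub> x \<otimes>\<^bsub>G\<^esub> g"

context group
begin

lemma inv_mult_cancel:
  assumes "x \<in> carrier G" "y \<in> carrier G"
  shows "inv x \<otimes> (x \<otimes> y) = y" "x \<otimes> (inv x \<otimes> y) = y"
  using assms by (simp_all add: m_assoc[symmetric])

lemma cj_closed [simp, intro]: "g \<in> carrier G \<Longrightarrow> x \<in> carrier G \<Longrightarrow> cj G g x \<in> carrier G"
  by (simp add: cj_def)

lemma cj_mult:
  "g \<in> carrier G \<Longrightarrow> x \<in> carrier G \<Longrightarrow> y \<in> carrier G \<Longrightarrow> cj G g (x \<otimes> y) = cj G g x \<otimes> cj G g y"
  by (simp add: cj_def m_assoc inv_mult_cancel)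

lemma cj_cj:
  "g \<in> carrier G \<Longrightarrow> h \<in> carrier G \<Longrightarrow> x \<in> carrier G \<Longrightarrow> cj G h (cj G g x) = cj G (g \<otimes> h) x"
  by (simp add: cj_def m_assoc inv_mult_group)

lemma cj_one [simp]: "x \<in> carrier G \<Longrightarrow> cj G \<one> x = x"
  by (simp add: cj_def)

lemma cj_one_right [simp]: "g \<in> carrier G \<Longrightarrow> cj G g \<one> = \<one>"
  by (simp add: cj_def)

lemma cj_inv: "g \<in> carrier G \<Longrightarrow> x \<in> carrier G \<Longrightarrow> cj G g (inv x) = inv (cj G g x)"
  by (simp add: cj_def m_assoc inv_mult_group)

lemma cj_eq_iff:
  "g \<in> carrier G \<Longrightarrow> x \<in> carrier G \<Longrightarrow> cj G g x = x \<longleftrightarrow> x \<otimes> g = g \<otimes> x"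
  by (metis cj_def inv_closed inv_solve_left m_assoc m_closed)

lemma commutator_closed [simp, intro]:
  "x \<in> carrier G \<Longrightarrow> y \<in> carrier G \<Longrightarrow> commutator G x y \<in> carrier G"
  by (simp add: commutator_def)

lemma commutator_eq_cj:
  "x \<in> carrier G \<Longrightarrow> y \<in> carrier G \<Longrightarrow> commutator G x y = inv x \<otimes> cj G y x"
  by (simp add: commutator_def cj_def m_assoc)

lemma inv_commutator:
  "x \<in> carrier G \<Longrightarrow> y \<in> carrier G \<Longrightarrow> inv (commutator G x y) = commutator G y x"
  by (simp add: commutator_def m_assoc inv_mult_group)

lemma cj_eq_mult_commutator:
  "x \<in> carrier G \<Longrightarrow> y \<in> carrier G \<Longrightarrow> cj G y x = x \<otimes> commutator G x y"
  by (simp add: commutator_eq_cj inv_mult_cancel)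

lemma normal_cj_closed: "N \<lhd> G \<Longrightarrow> g \<in> carrier G \<Longrightarrow> x \<in> N \<Longrightarrow> cj G g x \<in> N"
  unfolding cj_def by (rule normal.inv_op_closed1)

lemma normal_iff_cj_closed:
  "N \<lhd> G \<longleftrightarrow> subgroup N G \<and> (\<forall>g\<in>carrier G. \<forall>x\<in>N. cj G g x \<in> N)"
proof
  assume "N \<lhd> G"
  then show "subgroup N G \<and> (\<forall>g\<in>carrier G. \<forall>x\<in>N. cj G g x \<in> N)"
    using normal_cj_closed normal_imp_subgroup by blast
next
  assume *: "subgroup N G \<and> (\<forall>g\<in>carrier G. \<forall>x\<in>N. cj G g x \<in> N)"
  show "N \<lhd> G"
  proof (rule normal_invI)
    fix g x assume "g \<in> carrier G" "x \<in> N"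
    then have "cj G (inv g) x \<in> N" using * by simp
    then show "g \<otimes> x \<otimes> inv g \<in> N" by (simp add: cj_def \<open>g \<in> carrier G\<close>)
  qed (use * in simp)
qed

lemma subgroup_card_prime_power:
  assumes "subgroup H G" "order G = p ^ n" "Factorial_Ring.prime (p::nat)"
  shows "\<exists>k. card H = p ^ k"
  using lagrange[OF assms(1)] assms(2,3) divides_primepow_nat[of p "card H" n]
  by (metis dvd_triv_right)

end

text \<open>Orbit sizes divide \<open>p ^ n\<close>, so an orbit that is not a singleton has size
  divisible by \<open>p\<close>. If \<open>x0\<close> were the only fixed point,
  \<open>card E\<close> would be 1 modulo \<open>p\<close>.\<close>

lemma (in group_action) ex_other_fixed_point:
  assumes "order G = p ^ n" "Factorial_Ring.prime (p::nat)" "finite E" "p dvd card E"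
    and x0: "x0 \<in> E" "\<forall>g\<in>carrier G. \<phi> g x0 = x0"
  shows "\<exists>x\<in>E - {x0}. \<forall>g\<in>carrier G. \<phi> g x = x"
proof (rule ccontr)
  assume none: "\<not> ?thesis"
  interpret group G using group_hom group_hom.axioms(1) by auto
  have orb0: "orbit G \<phi> x0 = {x0}"
    using x0 orbit_refl[OF x0(1)] by (auto simp: orbit_def)
  have dvd: "p dvd card R" if R: "R \<in> orbits G E \<phi> - {{x0}}" for R
  proof -
    obtain x where x: "x \<in> E" "R = orbit G \<phi> x" using R unfolding orbits_def by auto
    have "x \<noteq> x0" using x R orb0 by auto
    then obtain g where g: "g \<in> carrier G" "\<phi> g x \<noteq> x" using none x by blast
    have "\<phi> g x \<in> R" "x \<in> R" using x g orbit_refl unfolding orbit_def by auto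
    then have "card R \<noteq> 1" using g by (auto simp: card_1_singleton_iff)
    moreover have "card R dvd p ^ n"
      using orbit_stabilizer_theorem[OF x(1)] assms(1) x(2) by (metis dvd_triv_left)
    ultimately show ?thesis using assms(2)
      by (metis divides_primepow_nat dvd_power less_one neq0_conv power_0)
  qed
  have fin: "finite (orbits G E \<phi>)"
    using assms(3) unfolding orbits_def by simp
  have mem: "{x0} \<in> orbits G E \<phi>" using orb0 x0 unfolding orbits_def by auto
  have "card E = (\<Sum>R\<in>orbits G E \<phi>. card R)"
    using disjoint_sum[OF assms(3), of "\<lambda>_. 1::nat"] by simp
  also have "\<dots> = 1 + (\<Sum>R\<in>orbits G E \<phi> - {{x0}}. card R)"
    using sum.remove[OF fin mem, of card] by simp
  finally have "card E = 1 + (\<Sum>R\<in>orbits G E \<phi> - {{x0}}. card R)" .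
  moreover have "p dvd (\<Sum>R\<in>orbits G E \<phi> - {{x0}}. card R)"
    using dvd by (rule dvd_sum)
  ultimately have "p dvd 1" using assms(4) by (metis dvd_add_left_iff)
  then show False using assms(2) by simp
qed

context group
begin

text \<open>\<open>A\<close> permutes the right cosets of \<open>U\<close> in \<open>W\<close> by
  conjugation. Their number is divisible by \<open>p\<close> and the coset \<open>U\<close> is
  fixed, so a second coset is fixed as well; it supplies \<open>c\<close>.\<close>

lemma ex_commutators_in_subgroup:
  assumes A: "subgroup A G" and U: "subgroup U G" and W: "subgroup W G" and "U \<subset> W"
    and ord: "order G = p ^ n" "Factorial_Ring.prime (p::nat)"
    and invU: "\<And>a x. a \<in> A \<Longrightarrow> x \<in> U \<Longrightarrow> cj G a x \<in> U"
    and invW: "\<And>a x. a \<in> A \<Longrightarrow> x \<in> W \<Longrightarrow> cj G a x \<in> W"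
  shows "\<exists>c\<in>W - U. \<forall>a\<in>A. commutator G c a \<in> U"
proof -
  have fin: "finite (carrier G)"
    using ord prime_gt_0_nat[OF ord(2)] by (simp flip: order_gt_0_iff_finite)
  let ?A = "G\<lparr>carrier := A\<rparr>"
  define \<Omega> where "\<Omega> = (\<lambda>w. U #> w) ` W"
  \<comment> \<open>\<open>cj\<close> is a right action whereas \<open>group_action\<close> asks for
    a homomorphism, hence the inverse. The restriction to \<open>\<Omega>\<close> makes
    \<open>\<phi> a\<close> extensional, as \<open>Bij\<close> demands.\<close>
  define \<phi> where "\<phi> = (\<lambda>a. \<lambda>T\<in>\<Omega>. cj G (inv a) ` T)"
  have Asub: "a \<in> carrier G" if "a \<in> A" for a by (rule subgroup.mem_carrier[OF A that])
  have Usub: "a \<in> carrier G" if "a \<in> U" for a by (rule subgroup.mem_carrier[OF U that])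
  have Wsub: "a \<in> carrier G" if "a \<in> W" for a by (rule subgroup.mem_carrier[OF W that])
  have Ainv: "inv a \<in> A" if "a \<in> A" for a using A that by (simp add: subgroup.m_inv_closed)
  have img: "cj G a ` (U #> w) = U #> cj G a w" if a: "a \<in> A" and w: "w \<in> W" for a w
  proof
    show "cj G a ` (U #> w) \<subseteq> U #> cj G a w"
    proof
      fix y assume "y \<in> cj G a ` (U #> w)"
      then obtain u where u: "u \<in> U" "y = cj G a (u \<otimes> w)" by (auto simp: r_coset_def)
      have "y = cj G a u \<otimes> cj G a w"
        using u cj_mult[OF Asub[OF a] Usub[OF u(1)] Wsub[OF w]] by simp
      then show "y \<in> U #> cj G a w"
        using invU[OF a u(1)] unfolding r_coset_def by blast
    qed
    show "U #> cj G a w \<subseteq> cj G a ` (U #> w)"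
    proof
      fix y assume "y \<in> U #> cj G a w"
      then obtain u where u: "u \<in> U" "y = u \<otimes> cj G a w" by (auto simp: r_coset_def)
      have "y = cj G a (cj G (inv a) u \<otimes> w)"
        using u Asub[OF a] Usub[OF u(1)] Wsub[OF w] by (simp add: cj_mult cj_cj)
      moreover have "cj G (inv a) u \<in> U" using invU Ainv a u by blast
      ultimately show "y \<in> cj G a ` (U #> w)" unfolding r_coset_def by blast
    qed
  qed
  have map: "cj G a ` T \<in> \<Omega>" if "a \<in> A" "T \<in> \<Omega>" for a T
    using that img invW unfolding \<Omega>_def by auto
  have Tsub: "T \<subseteq> carrier G" if "T \<in> \<Omega>" for T
    using that r_coset_subset_G[OF subgroup.subset[OF U] Wsub] unfolding \<Omega>_def by blast
  have comp: "cj G b ` cj G a ` T = cj G (a \<otimes> b) ` T" if "a \<in> A" "b \<in> A" "T \<in> \<Omega>" for a b T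
    using Tsub[OF that(3)] Asub[OF that(1)] Asub[OF that(2)] unfolding image_image
    by (intro image_cong) (auto simp: cj_cj)
  have idT: "cj G \<one> ` T = T" if "T \<in> \<Omega>" for T
    using Tsub[OF that] by (force simp: image_def)
  have Bij: "\<phi> a \<in> Bij \<Omega>" if a: "a \<in> A" for a
  proof -
    have "bij_betw (\<phi> a) \<Omega> \<Omega>"
    proof (rule bij_betw_byWitness[where f' = "\<lambda>T. cj G a ` T"])
      show "\<forall>T\<in>\<Omega>. cj G a ` \<phi> a T = T" "\<forall>T\<in>\<Omega>. \<phi> a (cj G a ` T) = T"
        using a comp idT map Ainv Asub unfolding \<phi>_def by simp_all
      show "\<phi> a ` \<Omega> \<subseteq> \<Omega>" "(`) (cj G a) ` \<Omega> \<subseteq> \<Omega>"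
        using map a Ainv unfolding \<phi>_def by auto
    qed
    then show ?thesis unfolding Bij_def \<phi>_def by simp
  qed
  have hom: "group_hom ?A (BijGroup \<Omega>) \<phi>"
  proof (intro group_hom.intro group_hom_axioms.intro)
    show "group ?A" using A by (rule subgroup_imp_group)
    show "group (BijGroup \<Omega>)" by (rule group_BijGroup)
    show "\<phi> \<in> hom ?A (BijGroup \<Omega>)"
    proof (rule homI)
      fix a assume "a \<in> carrier ?A"
      then show "\<phi> a \<in> carrier (BijGroup \<Omega>)" using Bij by (simp add: BijGroup_def)
    next
      fix a b assume "a \<in> carrier ?A" "b \<in> carrier ?A"
      then have ab: "a \<in> A" "b \<in> A" by auto
      have "\<phi> (a \<otimes> b) T = compose \<Omega> (\<phi> a) (\<phi> b) T" for T
        using ab map[OF Ainv[OF ab(2)]] comp Ainv Asub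
        by (cases "T \<in> \<Omega>") (auto simp: \<phi>_def compose_def inv_mult_group)
      then show "\<phi> (a \<otimes>\<^bsub>?A\<^esub> b) = \<phi> a \<otimes>\<^bsub>BijGroup \<Omega>\<^esub> \<phi> b"
        using ab Bij by (auto simp: BijGroup_def)
    qed
  qed
  interpret act: group_action ?A \<Omega> \<phi> using hom by (rule group_action.intro)
  have UU: "U \<in> \<Omega>"
    unfolding \<Omega>_def using W U coset_mult_one subgroup.one_closed subgroup.subset
    by (metis image_eqI)
  have finW: "finite W" using fin W by (meson finite_subset subgroup.subset)
  have fin\<Omega>: "finite \<Omega>" unfolding \<Omega>_def using finW by simp
  have card\<Omega>: "card \<Omega> * card U = card W"
  proof -
    have "subgroup U (G\<lparr>carrier := W\<rparr>)" 
      using subgroup_incl[OF U W] \<open>U \<subset> W\<close> by blast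
    from group.lagrange[OF subgroup_imp_group[OF W] this]
    have "card (rcosets\<^bsub>G\<lparr>carrier := W\<rparr>\<^esub> U) * card U = card W" by (simp add: order_def)
    moreover have "rcosets\<^bsub>G\<lparr>carrier := W\<rparr>\<^esub> U = \<Omega>"
      by (auto simp: RCOSETS_def \<Omega>_def r_coset_def)
    ultimately show ?thesis by simp
  qed
  have p\<Omega>: "p dvd card \<Omega>"
  proof -
    have "card \<Omega> \<noteq> 1" using card\<Omega> psubset_card_mono[OF finW \<open>U \<subset> W\<close>] by auto
    moreover obtain k where "card W = p ^ k"
      using subgroup_card_prime_power[OF W ord] by blast
    ultimately show ?thesis using card\<Omega> ord(2)
      by (metis divides_primepow_nat dvd_power dvd_triv_left less_one neq0_conv power_0)
  qed
  obtain k where ordA: "order ?A = p ^ k"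
    using subgroup_card_prime_power[OF A ord] by (auto simp: order_def)
  have fixU: "\<forall>a\<in>carrier ?A. \<phi> a U = U"
  proof
    fix a assume "a \<in> carrier ?A"
    then have a: "inv a \<in> A" using Ainv by simp
    have "U = U #> \<one>" using U by (simp add: subgroup.subset)
    then have "cj G (inv a) ` U = U"
      using img[OF a subgroup.one_closed[OF W]] Asub[OF a] by simp
    then show "\<phi> a U = U" using UU unfolding \<phi>_def by simp
  qed
  obtain T where T: "T \<in> \<Omega>" "T \<noteq> U" "\<forall>a\<in>A. \<phi> a T = T"
    using act.ex_other_fixed_point[OF ordA ord(2) fin\<Omega> p\<Omega> UU fixU] by auto
  obtain w where w: "w \<in> W" "T = U #> w" using T unfolding \<Omega>_def by auto
  have "w \<notin> U" using T w U Wsub by (metis coset_join2)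
  \<comment> \<open>The witness is \<open>inv w\<close>: from \<open>w^a = u w\<close> one gets
    \<open>[w^-1, a] = w (u w)^-1 = u^-1\<close>, which lies in \<open>U\<close>. In contrast
    \<open>[w, a] = w^-1 u w\<close> may leave \<open>U\<close>, which is not assumed normal in
    \<open>W\<close>.\<close>
  then have "inv w \<notin> U" using U w Wsub by (metis inv_inv subgroup.m_inv_closed)
  moreover have "commutator G (inv w) a \<in> U" if a: "a \<in> A" for a
  proof -
    have "\<phi> (inv a) T = T" using T a Ainv by blast
    then have "cj G a ` T = T" using a Asub T(1) unfolding \<phi>_def by simp
    moreover have "w \<in> T" using w U Wsub rcos_self by blast
    ultimately have "cj G a w \<in> U #> w" using w by auto
    then obtain u where u: "u \<in> U" "cj G a w = u \<otimes> w" by (auto simp: r_coset_def)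
    then have "commutator G (inv w) a = inv u"
      using a w Asub Wsub Usub
      by (simp add: commutator_eq_cj cj_inv inv_mult_group inv_mult_cancel)
    then show ?thesis using u U by (simp add: subgroup.m_inv_closed)
  qed
  ultimately show ?thesis using w W by (intro bexI[of _ "inv w"]) (auto simp: subgroup.m_inv_closed)
qed

end

section \<open>Quadratic subgroups\<close>

text \<open>The centralizer of \<open>F\<close> in \<open>W\<close>, phrased through
  conjugation.\<close>

definition fixed_by :: "('a, 'b) monoid_scheme \<Rightarrow> 'a set \<Rightarrow> 'a set \<Rightarrow> 'a set" where
  "fixed_by G W F = {w \<in> W. \<forall>f\<in>F. cj G f w = w}"

context group
begin

lemma subgroup_fixed_by:
  assumes W: "subgroup W G" and F: "F \<subseteq> carrier G"
  shows "subgroup (fixed_by G W F) G"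
proof (rule subgroupI)
  have sub: "w \<in> carrier G" if "w \<in> W" for w by (rule subgroup.mem_carrier[OF W that])
  have fsub: "w \<in> carrier G" if "w \<in> F" for w using F that by blast
  show "fixed_by G W F \<subseteq> carrier G" using sub unfolding fixed_by_def by blast
  have "\<one> \<in> fixed_by G W F"
    using subgroup.one_closed[OF W] fsub unfolding fixed_by_def by simp
  then show "fixed_by G W F \<noteq> {}" by blast
  fix x assume x: "x \<in> fixed_by G W F"
  then show "inv x \<in> fixed_by G W F"
    using subgroup.m_inv_closed[OF W] fsub sub unfolding fixed_by_def by (simp add: cj_inv)
  fix y assume "y \<in> fixed_by G W F"
  then show "x \<otimes> y \<in> fixed_by G W F"
    using x subgroup.m_closed[OF W] fsub sub unfolding fixed_by_def by (simp add: cj_mult)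
qed

lemma subgroup_fixing:
  assumes F: "subgroup F G" and M: "M \<subseteq> carrier G"
  shows "subgroup {g \<in> F. \<forall>m\<in>M. cj G g m = m} G"
proof (rule subgroupI)
  have sub: "w \<in> carrier G" if "w \<in> F" for w by (rule subgroup.mem_carrier[OF F that])
  have msub: "w \<in> carrier G" if "w \<in> M" for w using M that by blast
  let ?H = "{g \<in> F. \<forall>m\<in>M. cj G g m = m}"
  show "?H \<subseteq> carrier G" using sub by blast
  have "\<one> \<in> ?H" using subgroup.one_closed[OF F] msub by simp
  then show "?H \<noteq> {}" by blast
  fix x assume x: "x \<in> ?H"
  have "cj G (inv x) m = m" if m: "m \<in> M" for m
  proof -
    have xc: "x \<in> carrier G" "cj G x m = m" using x m sub by auto
    then have "cj G (inv x) m = cj G (inv x) (cj G x m)" by simp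
    also have "\<dots> = m" using xc(1) msub[OF m] by (simp add: cj_cj)
    finally show ?thesis .
  qed
  then show "inv x \<in> ?H" using x subgroup.m_inv_closed[OF F] by blast
  fix y assume y: "y \<in> ?H"
  have "cj G (x \<otimes> y) m = m" if m: "m \<in> M" for m
    using x y m sub msub[OF m] by (simp flip: cj_cj)
  then show "x \<otimes> y \<in> ?H" using x y subgroup.m_closed[OF F] by blast
qed

end

section \<open>Counting for an abelian group acting by conjugation on an abelian group\<close>

locale abelian_action = group +
  fixes W F
  assumes W: "subgroup W G" and F: "subgroup F G"
    and W_comm: "\<And>x y. x \<in> W \<Longrightarrow> y \<in> W \<Longrightarrow> x \<otimes> y = y \<otimes> x"
    and F_comm: "\<And>x y. x \<in> F \<Longrightarrow> y \<in> F \<Longrightarrow> x \<otimes> y = y \<otimes> x"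
    and cj_W: "\<And>f w. f \<in> F \<Longrightarrow> w \<in> W \<Longrightarrow> cj G f w \<in> W"
begin

abbreviation "C \<equiv> fixed_by G W F"

text \<open>The centralizer of \<open>[v, F]\<close> in \<open>F\<close>.\<close>

definition "comm_fixer v = {b \<in> F. \<forall>f\<in>F. cj G b (commutator G v f) = commutator G v f}"
text \<open>The plain set of products of a commutator \<open>[v, f]\<close> with an element of
  \<open>C\<close>, not the subgroup generated by them: this set is what gets counted.\<close>

definition "comm_prod v = (\<lambda>(f, c). commutator G v f \<otimes> c) ` (F \<times> C)"

lemma W_carrier: "w \<in> W \<Longrightarrow> w \<in> carrier G"
  by (rule subgroup.mem_carrier[OF W])

lemma F_carrier: "f \<in> F \<Longrightarrow> f \<in> carrier G"
  by (rule subgroup.mem_carrier[OF F])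

lemma commutator_W: "v \<in> W \<Longrightarrow> f \<in> F \<Longrightarrow> commutator G v f \<in> W"
  by (simp add: commutator_eq_cj W_carrier F_carrier W cj_W subgroup.m_closed subgroup.m_inv_closed)

lemma C_subgroup: "subgroup C G"
  using subgroup_fixed_by[OF W subgroup.subset[OF F]] .

lemma C_subset: "C \<subseteq> W" unfolding fixed_by_def by blast

lemma C_cj: "c \<in> C \<Longrightarrow> f \<in> F \<Longrightarrow> cj G f c = c" unfolding fixed_by_def by blast

lemma comm_prod_subset: "v \<in> W \<Longrightarrow> comm_prod v \<subseteq> W"
  unfolding comm_prod_def using commutator_W C_subset subgroup.m_closed[OF W] by auto

lemma comm_fixer_subgroup:
  assumes "v \<in> W" shows "subgroup (comm_fixer v) G"
proof -
  have eq: "comm_fixer v = {b \<in> F. \<forall>m\<in>commutator G v ` F. cj G b m = m}" unfolding comm_fixer_def by auto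
  have sub: "commutator G v ` F \<subseteq> carrier G" using commutator_W[OF assms] W_carrier by blast
  show ?thesis unfolding eq using F sub by (rule subgroup_fixing)
qed

lemma comm_prod_fixed:
  assumes v: "v \<in> W" shows "comm_prod v \<subseteq> fixed_by G W (comm_fixer v)"
proof
  fix y assume y: "y \<in> comm_prod v"
  then obtain f c where fc: "f \<in> F" "c \<in> C" "y = commutator G v f \<otimes> c" unfolding comm_prod_def by auto
  have "cj G b y = y" if b: "b \<in> comm_fixer v" for b
  proof -
    have bF: "b \<in> F" "cj G b (commutator G v f) = commutator G v f"
      using b fc unfolding comm_fixer_def by auto
    have c: "c \<in> carrier G" using fc C_subset W_carrier by blast
    show ?thesis
      using bF fc C_cj[OF fc(2) bF(1)] c W_carrier[OF commutator_W[OF v fc(1)]] F_carrier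
      by (simp add: cj_mult)
  qed
  then show "y \<in> fixed_by G W (comm_fixer v)" using y comm_prod_subset[OF v] unfolding fixed_by_def by blast
qed

text \<open>Equal products mean \<open>v^f = v^g z\<close> with \<open>z\<close> in
  \<open>C\<close>, so \<open>k = f g^-1\<close> sends \<open>v\<close> to \<open>v z\<close>. As
  \<open>F\<close> is abelian, \<open>k\<close> also sends \<open>v^h\<close> to
  \<open>v^h z\<close> for each \<open>h\<close> in \<open>F\<close>. Hence
  \<open>[v, h]^k = (v z)^-1 v^h z = [v, h]^z\<close>, which is \<open>[v, h]\<close> because
  \<open>W\<close> is abelian.\<close>

lemma commutator_eq_mod_C:
  assumes v: "v \<in> W" and f: "f \<in> F" and g: "g \<in> F" and c: "c \<in> C" and d: "d \<in> C"
    and eq: "commutator G v f \<otimes> c = commutator G v g \<otimes> d"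
  shows "f \<otimes> inv g \<in> comm_fixer v"
proof -
  let ?k = "f \<otimes> inv g"
  define z where "z = d \<otimes> inv c"
  have car: "v \<in> carrier G" "f \<in> carrier G" "g \<in> carrier G" "c \<in> carrier G" "d \<in> carrier G"
    using v f g c d W_carrier F_carrier C_subset by auto
  have zC: "z \<in> C"
    unfolding z_def using c d C_subgroup by (simp add: subgroup.m_closed subgroup.m_inv_closed)
  then have z: "z \<in> W" "z \<in> carrier G" using C_subset W_carrier by auto
  have ginv: "inv g \<in> F" using F g by (rule subgroup.m_inv_closed)
  have k: "?k \<in> F" using F f ginv by (rule subgroup.m_closed)
  have "cj G f v \<otimes> c = cj G g v \<otimes> d"
    using eq car by (simp add: commutator_eq_cj m_assoc)
  then have fz: "cj G f v = cj G g v \<otimes> z"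
    unfolding z_def using car by (metis cj_closed inv_closed inv_solve_right m_assoc m_closed)
  have "cj G ?k v = cj G (inv g) (cj G f v)" using car by (simp add: cj_cj)
  also have "\<dots> = cj G (inv g) (cj G g v) \<otimes> cj G (inv g) z"
    unfolding fz using car z by (simp add: cj_mult)
  also have "\<dots> = v \<otimes> z" using car C_cj[OF zC ginv] by (simp add: cj_cj)
  finally have kv: "cj G ?k v = v \<otimes> z" .
  have "cj G ?k (commutator G v h) = commutator G v h" if h: "h \<in> F" for h
  proof -
    have hc: "h \<in> carrier G" using h F_carrier by blast
    have m: "commutator G v h \<in> W" using v h by (rule commutator_W)
    have "cj G ?k (cj G h v) = cj G h (cj G ?k v)"
      using car hc F_comm[OF h k] by (simp add: cj_cj)
    also have "\<dots> = cj G h v \<otimes> z"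
      unfolding kv using car hc z C_cj[OF zC h] by (simp add: cj_mult)
    finally have "cj G ?k (commutator G v h) = inv (v \<otimes> z) \<otimes> (cj G h v \<otimes> z)"
      using car hc by (simp add: commutator_eq_cj cj_mult cj_inv kv)
    also have "\<dots> = cj G z (commutator G v h)"
      using car hc z by (simp add: commutator_eq_cj cj_def[of G z] inv_mult_group m_assoc)
    also have "\<dots> = commutator G v h"
      using cj_eq_iff[OF z(2) W_carrier[OF m]] W_comm[OF m z(1)] by simp
    finally show ?thesis .
  qed
  then show ?thesis unfolding comm_fixer_def using k by blast
qed

text \<open>By \<open>commutator_eq_mod_C\<close> the fibres of the product map from
  \<open>F \<times> C\<close> onto \<open>comm_prod v\<close> have at most
  \<open>card (comm_fixer v)\<close> elements, since within a fibre the first component determines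
  the second.\<close>

lemma card_le_comm_fixer_prod:
  assumes v: "v \<in> W" and fin: "finite F" "finite W"
  shows "card F * card C \<le> card (comm_fixer v) * card (comm_prod v)"
proof -
  let ?\<phi> = "\<lambda>(f, c). commutator G v f \<otimes> c"
  \<comment> \<open>\<open>r\<close> chooses a representative in each fibre. A pair
    \<open>(f, c)\<close> is then recovered from its product and from the quotient of
    \<open>f\<close> by the first component of the representative.\<close>
  define r where "r = inv_into (F \<times> C) ?\<phi>"
  have r: "r y \<in> F \<times> C" "?\<phi> (r y) = y" if "y \<in> comm_prod v" for y
    using that unfolding r_def comm_prod_def by (rule inv_into_into, rule f_inv_into_f)
  let ?\<psi> = "\<lambda>x. (fst x \<otimes> inv (fst (r (?\<phi> x))), ?\<phi> x)"
  have finC: "finite C" using C_subset fin(2) by (rule finite_subset)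
  have "inj_on ?\<psi> (F \<times> C)"
  proof (rule inj_onI)
    fix x y assume x: "x \<in> F \<times> C" and y: "y \<in> F \<times> C" and eq: "?\<psi> x = ?\<psi> y"
    have \<phi>: "?\<phi> x = ?\<phi> y" using eq by simp
    have "?\<phi> x \<in> comm_prod v" using x unfolding comm_prod_def by (rule imageI)
    then have "fst (r (?\<phi> x)) \<in> carrier G" using r(1) F_carrier by force
    moreover have "fst x \<otimes> inv (fst (r (?\<phi> x))) = fst y \<otimes> inv (fst (r (?\<phi> x)))"
      using eq \<phi> by simp
    moreover have "fst x \<in> carrier G" "fst y \<in> carrier G" using x y F_carrier by auto
    ultimately have 1: "fst x = fst y" by simp
    have "commutator G v (fst x) \<otimes> snd x = commutator G v (fst x) \<otimes> snd y"
      using \<phi> 1 by (simp add: case_prod_beta)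
    moreover have "commutator G v (fst x) \<in> carrier G" "snd x \<in> carrier G" "snd y \<in> carrier G"
      using x y v W_carrier F_carrier C_subset by auto
    ultimately have "snd x = snd y" by simp
    with 1 show "x = y" by (rule prod_eqI)
  qed
  moreover have "?\<psi> ` (F \<times> C) \<subseteq> comm_fixer v \<times> comm_prod v"
  proof
    fix q assume "q \<in> ?\<psi> ` (F \<times> C)"
    then obtain f c where x: "f \<in> F" "c \<in> C" "q = ?\<psi> (f, c)" by auto
    have I: "?\<phi> (f, c) \<in> comm_prod v" unfolding comm_prod_def using x by blast
    obtain g d where gd: "r (?\<phi> (f, c)) = (g, d)" by fastforce
    have "g \<in> F" "d \<in> C" "?\<phi> (g, d) = ?\<phi> (f, c)" using r[OF I] gd by auto
    then have "f \<otimes> inv g \<in> comm_fixer v" using commutator_eq_mod_C[OF v x(1) _ x(2)] by simp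
    then show "q \<in> comm_fixer v \<times> comm_prod v" using I x gd by simp
  qed
  moreover have "finite (comm_fixer v \<times> comm_prod v)" using fin finC unfolding comm_fixer_def comm_prod_def by simp
  ultimately have "card (F \<times> C) \<le> card (comm_fixer v \<times> comm_prod v)" by (rule card_inj_on_le)
  then show ?thesis by (simp add: card_cartesian_product)
qed

text \<open>A nontrivial action of a \<open>p\<close>-group on a \<open>p\<close>-group satisfies
  \<open>[W, F] C < W\<close>. Take for \<open>U\<close> a largest proper \<open>F\<close>-invariant
  subgroup above \<open>C\<close>: the elements of \<open>W\<close> that \<open>F\<close> fixes
  modulo \<open>U\<close> form a strictly larger invariant subgroup, which must be
  \<open>W\<close>.\<close>

lemma ex_proper_subgroup_commutators:
  assumes ord: "order G = p ^ n" "Factorial_Ring.prime (p::nat)" and "C \<noteq> W"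
  shows "\<exists>U. subgroup U G \<and> U \<subset> W \<and> C \<subseteq> U \<and> (\<forall>w\<in>W. \<forall>f\<in>F. commutator G w f \<in> U)"
proof -
  let ?P = "\<lambda>U. subgroup U G \<and> U \<subset> W \<and> C \<subseteq> U \<and> (\<forall>f\<in>F. \<forall>u\<in>U. cj G f u \<in> U)"
  have finW: "finite W"
    using ord prime_gt_0_nat[OF ord(2)] finite_subset[OF subgroup.subset[OF W]]
    by (simp flip: order_gt_0_iff_finite)
  have "?P C" using C_subgroup C_subset assms(3) C_cj by auto
  moreover have "\<forall>U. ?P U \<longrightarrow> card U < Suc (card W)"
    using card_mono[OF finW] by (auto simp: less_Suc_eq_le)
  ultimately obtain U where PU: "?P U" and max: "\<And>V. ?P V \<Longrightarrow> card V \<le> card U"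
    using ex_has_greatest_nat[of ?P C card "Suc (card W)"] by blast
  \<comment> \<open>\<open>V\<close> consists of the elements of \<open>W\<close> whose cosets
    modulo \<open>U\<close> are fixed by \<open>F\<close>.\<close>
  define V where "V = {w \<in> W. \<forall>f\<in>F. commutator G w f \<in> U}"
  have U: "subgroup U G" using PU by blast
  have UW: "u \<in> W" if "u \<in> U" for u using PU that by blast
  have UV: "U \<subseteq> V"
  proof
    fix u assume u: "u \<in> U"
    have "commutator G u f \<in> U" if "f \<in> F" for f
    proof -
      have "cj G f u \<in> U" using PU u that by blast
      then have "inv u \<otimes> cj G f u \<in> U" by (rule subgroup.m_closed[OF U subgroup.m_inv_closed[OF U u]])
      then show ?thesis
        using commutator_eq_cj[OF W_carrier[OF UW[OF u]] F_carrier[OF that]] by simp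
    qed
    then show "u \<in> V" using UW[OF u] unfolding V_def by blast
  qed
  \<comment> \<open>For fixed \<open>f\<close>, taking commutators is a homomorphism on the abelian
    group \<open>W\<close>. This makes \<open>V\<close> a subgroup.\<close>
  have mult: "commutator G (x \<otimes> y) f = commutator G x f \<otimes> commutator G y f"
    if x: "x \<in> W" and y: "y \<in> W" and f: "f \<in> F" for x y f
  proof -
    have car: "x \<in> carrier G" "y \<in> carrier G" "f \<in> carrier G" using x y f W_carrier F_carrier by auto
    have "commutator G (x \<otimes> y) f = inv y \<otimes> (commutator G x f \<otimes> cj G f y)"
      using car by (simp add: commutator_eq_cj cj_mult inv_mult_group m_assoc)
    also have "\<dots> = commutator G x f \<otimes> inv y \<otimes> cj G f y"
      using W_comm[OF subgroup.m_inv_closed[OF W y] commutator_W[OF x f]] car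
      by (simp flip: m_assoc)
    finally show ?thesis using car by (simp add: commutator_eq_cj[of y] m_assoc)
  qed
  have V: "subgroup V G"
  proof (rule subgroupI)
    show "V \<subseteq> carrier G" using W_carrier unfolding V_def by blast
    show "V \<noteq> {}" using UV U subgroup.one_closed by blast
    fix x assume x: "x \<in> V"
    then have xW: "x \<in> W" unfolding V_def by blast
    have xi: "inv x \<in> W" using W xW by (rule subgroup.m_inv_closed)
    have "commutator G (inv x) f \<in> U" if f: "f \<in> F" for f
    proof -
      have "commutator G (inv x) f \<otimes> commutator G x f = commutator G (inv x \<otimes> x) f"
        using mult[OF xi xW f] by simp
      also have "\<dots> = \<one>"
        using xW f W_carrier F_carrier by (simp add: commutator_eq_cj)
      finally have "commutator G (inv x) f = inv (commutator G x f)"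
        using W_carrier commutator_W[OF xi f] commutator_W[OF xW f] inv_equality by metis
      then show ?thesis using x f subgroup.m_inv_closed[OF U] unfolding V_def by simp
    qed
    then show "inv x \<in> V" using xi unfolding V_def by blast
    fix y assume "y \<in> V"
    then show "x \<otimes> y \<in> V"
      using x mult subgroup.m_closed[OF W] subgroup.m_closed[OF U] unfolding V_def by simp
  qed
  have cjV: "cj G f x \<in> V" if f: "f \<in> F" and x: "x \<in> V" for f x
  proof -
    have "x \<in> W" "commutator G x f \<in> U" using f x unfolding V_def by auto
    then have "cj G f x = x \<otimes> commutator G x f"
      using cj_eq_mult_commutator f W_carrier F_carrier by blast
    then show ?thesis using x \<open>commutator G x f \<in> U\<close> UV subgroup.m_closed[OF V] by auto
  qed
  have "V = W"
  proof (rule ccontr)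
    assume "V \<noteq> W"
    moreover have "V \<subseteq> W" unfolding V_def by blast
    ultimately have "?P V" using V UV PU cjV by blast
    obtain c where "c \<in> W - U" "\<forall>a\<in>F. commutator G c a \<in> U"
      using ex_commutators_in_subgroup[OF F U W _ ord] PU cj_W by blast
    then have "c \<in> V - U" unfolding V_def by blast
    then have "U \<subset> V" using UV by blast
    then have "card U < card V" using finite_subset[OF \<open>V \<subseteq> W\<close> finW] by (rule psubset_card_mono[rotated])
    then show False using max[OF \<open>?P V\<close>] by simp
  qed
  then have "\<forall>w\<in>W. \<forall>f\<in>F. commutator G w f \<in> U" unfolding V_def by blast
  then show ?thesis using PU by (intro exI[of _ U]) simp
qed

end

text \<open>A form of Thompson--Timmesfeld replacement. Take \<open>H > K\<close> minimal with
  \<open>|K| |W| \<le> |H| |C\<^sub>W(H)|\<close>. The centralizer in \<open>H\<close> of any \<open>[v, H]\<close> satisfies the same inequality,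
  so it is \<open>H\<close> or \<open>K\<close>; the latter would force \<open>W = [v, H] C\<^sub>W(H)\<close>, which is impossible for a
  \<open>p\<close>-group acting nontrivially on a \<open>p\<close>-group.\<close>

theorem (in abelian_action) ex_quadratic_subgroup:
  assumes ord: "order G = p ^ n" "Factorial_Ring.prime (p::nat)"
    and K: "K = {f \<in> F. \<forall>w\<in>W. cj G f w = w}" "K \<noteq> F"
    and card: "card K * card W \<le> card F * card (fixed_by G W F)"
  shows "\<exists>H. subgroup H G \<and> K \<subset> H \<and> H \<subseteq> F \<and>
    (\<forall>v\<in>W. \<forall>f\<in>H. \<forall>g\<in>H. cj G g (commutator G v f) = commutator G v f)"
proof -
  let ?P = "\<lambda>H. subgroup H G \<and> K \<subset> H \<and> H \<subseteq> F \<and> card K * card W \<le> card H * card (fixed_by G W H)"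
  have fin: "finite (carrier G)"
    using ord prime_gt_0_nat[OF ord(2)] by (simp flip: order_gt_0_iff_finite)
  have "?P F" using F K card by auto
  then obtain H where PH: "?P H" and min: "\<And>H'. ?P H' \<Longrightarrow> card H \<le> card H'"
    using ex_has_least_nat[of ?P F card] by blast
  have HF: "H \<subseteq> F" using PH by blast
  have cardH: "card K * card W \<le> card H * card (fixed_by G W H)" using PH by blast
  have H: "subgroup H G" using PH by blast
  have H_comm: "x \<otimes> y = y \<otimes> x" if "x \<in> H" "y \<in> H" for x y
    using F_comm that HF by blast
  have cj_H: "cj G f w \<in> W" if "f \<in> H" "w \<in> W" for f w
    using cj_W that HF by blast
  interpret H: abelian_action G W H
    by (intro abelian_action.intro abelian_action_axioms.intro group_axioms W H W_comm H_comm cj_H)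
  have finW: "finite W" and finH: "finite H"
    using finite_subset[OF subgroup.subset[OF W] fin] finite_subset[OF subgroup.subset[OF H.F] fin]
    by simp_all
  have BH: "H.comm_fixer v = H" if v: "v \<in> W" for v
  proof (rule ccontr)
    assume ne: "H.comm_fixer v \<noteq> H"
    have BsubH: "H.comm_fixer v \<subseteq> H" unfolding H.comm_fixer_def by blast
    then have lt: "card (H.comm_fixer v) < card H" using ne finH by (simp add: psubsetI psubset_card_mono)
    have KB: "K \<subseteq> H.comm_fixer v"
      using PH K(1) H.commutator_W[OF v] unfolding H.comm_fixer_def by blast
    have le: "card H * card H.C \<le> card (H.comm_fixer v) * card (H.comm_prod v)"
      using H.card_le_comm_fixer_prod[OF v finH finW] .
    \<comment> \<open>All of \<open>H.comm_prod v\<close> is fixed by \<open>H.comm_fixer v\<close>,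
      so this smaller group inherits the inequality in \<open>?P\<close>. Minimality of
      \<open>H\<close> then forbids it to contain \<open>K\<close> properly.\<close>
    also have "\<dots> \<le> card (H.comm_fixer v) * card (fixed_by G W (H.comm_fixer v))"
    proof -
      have "finite (fixed_by G W (H.comm_fixer v))" using finW unfolding fixed_by_def by simp
      then show ?thesis using H.comm_prod_fixed[OF v] by (simp add: card_mono)
    qed
    finally have "card K * card W \<le> card (H.comm_fixer v) * card (fixed_by G W (H.comm_fixer v))"
      using cardH by (rule le_trans[rotated])
    then have "\<not> K \<subset> H.comm_fixer v"
      using min[of "H.comm_fixer v"] H.comm_fixer_subgroup[OF v] subset_trans[OF BsubH HF] lt by (metis not_less)
    then have "H.comm_fixer v = K" using KB by blast
    \<comment> \<open>With \<open>H.comm_fixer v = K\<close> the counting bound reads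
      \<open>|K| |W| \<le> |H| |C_W(H)| \<le> |K| |H.comm_prod v|\<close>; cancelling
      \<open>|K|\<close> leaves \<open>H.comm_prod v = W\<close>.\<close>
    then have "card K * card W \<le> card K * card (H.comm_prod v)"
      using le cardH by (metis le_trans)
    moreover have "card K > 0"
      using \<open>H.comm_fixer v = K\<close> H.comm_fixer_subgroup[OF v] finite_subset[OF BsubH finH]
      by (metis card_gt_0_iff empty_iff subgroup.one_closed)
    ultimately have IW: "H.comm_prod v = W"
      using H.comm_prod_subset[OF v] finW by (intro card_seteq) auto
    \<comment> \<open>Otherwise \<open>H\<close> would act trivially on \<open>W\<close> and be
      contained in \<open>K\<close>.\<close>
    have "H.C \<noteq> W"
    proof
      assume "H.C = W"
      then have "H \<subseteq> K" using H.C_cj HF K(1) by blast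
      then show False using PH by blast
    qed
    then obtain U where U: "subgroup U G" "U \<subset> W" "H.C \<subseteq> U"
      "\<forall>w\<in>W. \<forall>f\<in>H. commutator G w f \<in> U"
      using H.ex_proper_subgroup_commutators[OF ord] by blast
    \<comment> \<open>Both factors of a product in \<open>H.comm_prod v\<close> lie in the proper
      subgroup \<open>U\<close>, against \<open>H.comm_prod v = W\<close>.\<close>
    have "H.comm_prod v \<subseteq> U"
    proof
      fix y assume "y \<in> H.comm_prod v"
      then obtain f c where "f \<in> H" "c \<in> H.C" "y = commutator G v f \<otimes> c"
        unfolding H.comm_prod_def by auto
      then show "y \<in> U" using U(3,4) v subgroup.m_closed[OF U(1)] by blast
    qed
    then show False using IW U by blast
  qed
  have "cj G g (commutator G v f) = commutator G v f" if "v \<in> W" "f \<in> H" "g \<in> H" for v f g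
  proof -
    have "g \<in> H.comm_fixer v" using BH that by blast
    then show ?thesis using that(2) unfolding H.comm_fixer_def by blast
  qed
  then show ?thesis using PH by (intro exI[of _ H]) simp
qed

section \<open>Product sets of subgroups\<close>

context group
begin

text \<open>One half of the product formula. Choose a representative \<open>(k', w')\<close> for
  each product: if \<open>k w = k' w'\<close>, then \<open>k'^-1 k = w' w^-1\<close> lies in
  \<open>K \<inter> W\<close>, and this element together with the product determines
  \<open>(k, w)\<close>.\<close>

lemma card_set_mult_ge:
  assumes K: "subgroup K G" and W: "subgroup W G" and fin: "finite K" "finite W"
  shows "card K * card W \<le> card (K <#> W) * card (K \<inter> W)"
proof -
  let ?\<phi> = "\<lambda>(k, w). k \<otimes> w"
  have img: "K <#> W = ?\<phi> ` (K \<times> W)" unfolding set_mult_def by auto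
  define r where "r = inv_into (K \<times> W) ?\<phi>"
  have r: "r y \<in> K \<times> W" "?\<phi> (r y) = y" if "y \<in> K <#> W" for y
    using that unfolding r_def img by (rule inv_into_into, rule f_inv_into_f)
  have Kc: "k \<in> carrier G" if "k \<in> K" for k by (rule subgroup.mem_carrier[OF K that])
  have Wc: "w \<in> carrier G" if "w \<in> W" for w by (rule subgroup.mem_carrier[OF W that])
  let ?\<psi> = "\<lambda>x. (?\<phi> x, inv (fst (r (?\<phi> x))) \<otimes> fst x)"
  have "inj_on ?\<psi> (K \<times> W)"
  proof (rule inj_onI)
    fix x y assume x: "x \<in> K \<times> W" and y: "y \<in> K \<times> W" and eq: "?\<psi> x = ?\<psi> y"
    have \<phi>: "?\<phi> x = ?\<phi> y" using eq by simp
    have "?\<phi> x \<in> K <#> W" using x unfolding img by (rule imageI)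
    then have "fst (r (?\<phi> x)) \<in> carrier G" using r(1) Kc by force
    moreover have "inv (fst (r (?\<phi> x))) \<otimes> fst x = inv (fst (r (?\<phi> x))) \<otimes> fst y"
      using eq \<phi> by simp
    moreover have car: "fst x \<in> carrier G" "fst y \<in> carrier G" using x y Kc by auto
    ultimately have 1: "fst x = fst y" by simp
    have "fst x \<otimes> snd x = fst x \<otimes> snd y"
      using \<phi> 1 by (simp add: case_prod_beta)
    moreover have "snd x \<in> carrier G" "snd y \<in> carrier G" using x y Wc by auto
    ultimately have "snd x = snd y" using car by simp
    with 1 show "x = y" by (rule prod_eqI)
  qed
  moreover have "?\<psi> ` (K \<times> W) \<subseteq> (K <#> W) \<times> (K \<inter> W)"
  proof
    fix q assume "q \<in> ?\<psi> ` (K \<times> W)"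
    then obtain k w where x: "k \<in> K" "w \<in> W" "q = ?\<psi> (k, w)" by auto
    have I: "?\<phi> (k, w) \<in> K <#> W" unfolding img using x by blast
    obtain k' w' where r': "r (?\<phi> (k, w)) = (k', w')" by fastforce
    have k': "k' \<in> K" "w' \<in> W" and eq: "k' \<otimes> w' = k \<otimes> w" using r[OF I] r' by auto
    have "inv k' \<otimes> k = w' \<otimes> inv w"
      using eq Kc[OF x(1)] Kc[OF k'(1)] Wc[OF x(2)] Wc[OF k'(2)]
      by (metis inv_closed inv_solve_left inv_solve_right m_assoc m_closed)
    moreover have "inv k' \<otimes> k \<in> K"
      by (rule subgroup.m_closed[OF K subgroup.m_inv_closed[OF K k'(1)] x(1)])
    moreover have "w' \<otimes> inv w \<in> W"
      by (rule subgroup.m_closed[OF W k'(2) subgroup.m_inv_closed[OF W x(2)]])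
    ultimately show "q \<in> (K <#> W) \<times> (K \<inter> W)" using I x(3) r' by simp
  qed
  moreover have "finite ((K <#> W) \<times> (K \<inter> W))" using fin unfolding img by simp
  ultimately have "card (K \<times> W) \<le> card ((K <#> W) \<times> (K \<inter> W))" by (rule card_inj_on_le)
  then show ?thesis by (simp add: card_cartesian_product)
qed

text \<open>If \<open>f^g = n' f'\<close>, then \<open>(n f)^g = (n^g n') f'\<close>. Meant for a
  subgroup \<open>F\<close> that is central modulo \<open>N\<close> but perhaps not normal.\<close>

lemma normal_set_mult:
  assumes N: "N \<lhd> G" and F: "subgroup F G"
    and cj: "\<And>f g. f \<in> F \<Longrightarrow> g \<in> carrier G \<Longrightarrow> cj G g f \<in> N <#> F"
  shows "N <#> F \<lhd> G"
  unfolding normal_iff_cj_closed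
proof (intro conjI ballI)
  interpret second_isomorphism_grp N G F
    using N F by (intro second_isomorphism_grp.intro second_isomorphism_grp_axioms.intro)
  show "subgroup (N <#> F) G" by (rule normal_set_mult_subgroup)
  fix g y assume g: "g \<in> carrier G" and y: "y \<in> N <#> F"
  then obtain n f where nf: "n \<in> N" "f \<in> F" "y = n \<otimes> f" unfolding set_mult_def by blast
  obtain n' f' where nf': "n' \<in> N" "f' \<in> F" "cj G g f = n' \<otimes> f'"
    using cj[OF nf(2) g] unfolding set_mult_def by blast
  have n: "cj G g n \<in> N" using N g nf(1) by (rule normal_cj_closed)
  have car: "n \<in> carrier G" "f \<in> carrier G" "n' \<in> carrier G" "f' \<in> carrier G" "cj G g n \<in> carrier G"
    using nf nf' n mem_carrier subgroup.mem_carrier[OF F] by auto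
  have "cj G g y = cj G g n \<otimes> n' \<otimes> f'"
    using nf nf' car g by (simp add: cj_mult m_assoc)
  moreover have "cj G g n \<otimes> n' \<in> N" using n nf'(1) by (rule m_closed)
  ultimately show "cj G g y \<in> N <#> F" using nf'(2) unfolding set_mult_def by blast
qed

lemma subset_set_mult:
  assumes "subgroup N G" "subgroup F G"
  shows "N \<subseteq> N <#> F" "F \<subseteq> N <#> F"
proof -
  show "N \<subseteq> N <#> F"
  proof
    fix x assume x: "x \<in> N"
    then have "x = x \<otimes> \<one>" using assms by (simp add: subgroup.mem_carrier)
    then show "x \<in> N <#> F" using x subgroup.one_closed[OF assms(2)] unfolding set_mult_def by blast
  qed
  show "F \<subseteq> N <#> F"
  proof
    fix x assume x: "x \<in> F"
    then have "x = \<one> \<otimes> x" using assms by (simp add: subgroup.mem_carrier)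
    then show "x \<in> N <#> F" using x subgroup.one_closed[OF assms(1)] unfolding set_mult_def by blast
  qed
qed

lemma normal_set_mult_normal:
  assumes N: "N \<lhd> G" and F: "F \<lhd> G"
  shows "N <#> F \<lhd> G"
proof (rule normal_set_mult[OF N normal_imp_subgroup[OF F]])
  fix f g assume "f \<in> F" "g \<in> carrier G"
  then have "cj G g f \<in> F" using normal_cj_closed[OF F] by blast
  then show "cj G g f \<in> N <#> F"
    using subset_set_mult(2)[OF normal_imp_subgroup[OF N] normal_imp_subgroup[OF F]] by blast
qed

section \<open>Centralizers and \<open>Omega1\<close>\<close>

lemma centralizer_eq:
  assumes "Q \<subseteq> carrier G"
  shows "centralizer G Q = {g \<in> carrier G. \<forall>q\<in>Q. cj G g q = q}"
  using assms unfolding centralizer_def by (auto simp: cj_eq_iff subset_eq)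

lemma centralizer_subgroup: "Q \<subseteq> carrier G \<Longrightarrow> subgroup (centralizer G Q) G"
  unfolding centralizer_eq by (rule subgroup_fixing[OF subgroup_self])

lemma centralizer_antimono: "Q \<subseteq> R \<Longrightarrow> centralizer G R \<subseteq> centralizer G Q"
  unfolding centralizer_def by blast

lemma centralizer_commute: "c \<in> centralizer G Q \<Longrightarrow> q \<in> Q \<Longrightarrow> c \<otimes> q = q \<otimes> c"
  unfolding centralizer_def by blast

lemma centralizer_normal:
  assumes Q: "Q \<lhd> G"
  shows "centralizer G Q \<lhd> G"
  unfolding normal_iff_cj_closed
proof (intro conjI ballI)
  have Qc: "Q \<subseteq> carrier G" using normal_imp_subgroup[OF Q] by (rule subgroup.subset)
  show "subgroup (centralizer G Q) G" using Qc by (rule centralizer_subgroup)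
  fix g c assume g: "g \<in> carrier G" and c: "c \<in> centralizer G Q"
  have cc: "c \<in> carrier G" using c unfolding centralizer_def by blast
  have "cj G g c \<otimes> q = q \<otimes> cj G g c" if q: "q \<in> Q" for q
  proof -
    have qc: "q \<in> carrier G" using q Qc by blast
    define q' where "q' = cj G (inv g) q"
    have q': "q' \<in> Q" "q' \<in> carrier G" "q = cj G g q'"
      using normal_cj_closed[OF Q _ q] g qc by (auto simp: q'_def cj_cj)
    have "cj G g c \<otimes> q = cj G g (c \<otimes> q')" using q' g cc by (simp add: cj_mult)
    also have "\<dots> = cj G g (q' \<otimes> c)" using centralizer_commute[OF c q'(1)] by simp
    also have "\<dots> = q \<otimes> cj G g c" using q' g cc by (simp add: cj_mult)
    finally show ?thesis .
  qed
  then show "cj G g c \<in> centralizer G Q" using g cc unfolding centralizer_def by blast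
qed

lemma cj_pow: "g \<in> carrier G \<Longrightarrow> x \<in> carrier G \<Longrightarrow> cj G g x [^] (n::nat) = cj G g (x [^] n)"
  by (induction n) (simp_all add: cj_mult)

lemma ord_cj:
  assumes "g \<in> carrier G" "x \<in> carrier G"
  shows "ord (cj G g x) = ord x"
proof -
  have "cj G g y = \<one> \<longleftrightarrow> y = \<one>" if y: "y \<in> carrier G" for y
  proof
    assume "cj G g y = \<one>"
    then have "cj G (inv g) (cj G g y) = \<one>" using assms by simp
    then show "y = \<one>" using assms y by (simp add: cj_cj)
  qed (use assms in simp)
  then show ?thesis
    using assms by (simp add: ord_unique cj_pow pow_eq_id)
qed

lemma Omega1_subset:
  assumes "subgroup H G" shows "Omega1 G p H \<subseteq> H"
  unfolding Omega1_def using assms by (intro generate_subgroup_incl) auto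

lemma Omega1_mono: "H \<subseteq> H' \<Longrightarrow> Omega1 G p H \<subseteq> Omega1 G p H'"
  unfolding Omega1_def by (rule mono_generate) blast

lemma Omega1_normal:
  assumes H: "H \<lhd> G" shows "Omega1 G p H \<lhd> G"
  unfolding Omega1_def
proof (rule normal_generateI)
  have sub: "H \<subseteq> carrier G" using normal_imp_subgroup[OF H] by (rule subgroup.subset)
  then show "{x \<in> H. ord x = p} \<subseteq> carrier G" by blast
  fix h g assume h: "h \<in> {x \<in> H. ord x = p}" and g: "g \<in> carrier G"
  have "g \<otimes> h \<otimes> inv g = cj G (inv g) h" using g by (simp add: cj_def)
  moreover have "cj G (inv g) h \<in> H" using normal_cj_closed[OF H] h g by simp
  moreover have "ord (cj G (inv g) h) = p" using ord_cj[of "inv g" h] h g sub by auto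
  ultimately show "g \<otimes> h \<otimes> inv g \<in> {x \<in> H. ord x = p}" by simp
qed

section \<open>Iterated commutators\<close>

lemma comm_subgroup_subset:
  assumes "subgroup H G" "\<And>a b. a \<in> A \<Longrightarrow> b \<in> B \<Longrightarrow> commutator G a b \<in> H"
  shows "comm_subgroup G A B \<subseteq> H"
  unfolding comm_subgroup_def using assms by (intro generate_subgroup_incl) auto

lemma one_in_iter_comm: "\<one> \<in> A \<Longrightarrow> \<one> \<in> iter_comm G A B k"
  by (cases k) (simp_all add: comm_subgroup_def generate.one)

lemma iter_comm_subset_normal:
  assumes D: "D \<lhd> G" and B: "B \<subseteq> carrier G"
  shows "iter_comm G D B k \<subseteq> D"
proof (induction k)
  case (Suc k)
  have sg: "subgroup D G" using D by (rule normal_imp_subgroup)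
  have "commutator G a b \<in> D" if a: "a \<in> D" and b: "b \<in> B" for a b
  proof -
    have car: "a \<in> carrier G" "b \<in> carrier G" using B b subgroup.mem_carrier[OF sg a] by auto
    have "cj G b a \<in> D" using D car(2) a by (rule normal_cj_closed)
    then have "inv a \<otimes> cj G b a \<in> D" by (rule subgroup.m_closed[OF sg subgroup.m_inv_closed[OF sg a]])
    then show ?thesis using car by (simp add: commutator_eq_cj)
  qed
  then have "comm_subgroup G (iter_comm G D B k) B \<subseteq> D"
    using Suc by (intro comm_subgroup_subset[OF sg]) blast
  then show ?case by simp
qed simp

text \<open>The iterated commutators stay in the normal subgroup \<open>D\<close>, which
  \<open>Q\<close> centralizes, so \<open>[d, q r] = [d, r]\<close> at every level. The larger
  \<open>D'\<close> allows the comparison with the chain condition of another subgroup.\<close>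

lemma iter_comm_set_mult:
  assumes D: "D \<lhd> G" and "D \<subseteq> D'" and "D \<subseteq> centralizer G Q"
    and Q: "Q \<subseteq> carrier G" and R: "R \<subseteq> carrier G"
  shows "iter_comm G D (Q <#> R) k \<subseteq> iter_comm G D' R k"
proof (induction k)
  case 0
  then show ?case using assms(2) by simp
next
  case (Suc k)
  have QR: "Q <#> R \<subseteq> carrier G" using Q R by (rule setmult_subset_G)
  have "commutator G d y \<in> {commutator G a b | a b. a \<in> iter_comm G D' R k \<and> b \<in> R}"
    if d: "d \<in> iter_comm G D (Q <#> R) k" and y: "y \<in> Q <#> R" for d y
  proof -
    have dD: "d \<in> D" using iter_comm_subset_normal[OF D QR] d by blast
    have dc: "d \<in> carrier G" using subgroup.mem_carrier[OF normal_imp_subgroup[OF D] dD] .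
    obtain q r where qr: "q \<in> Q" "r \<in> R" "y = q \<otimes> r" using y unfolding set_mult_def by blast
    have car: "q \<in> carrier G" "r \<in> carrier G" using qr Q R by auto
    have "cj G q d = d"
      using cj_eq_iff[OF car(1) dc] centralizer_commute[of d Q q] dD assms(3) qr by auto
    then have "commutator G d y = commutator G d r"
      using qr(3) dc car by (simp add: commutator_eq_cj flip: cj_cj)
    then show ?thesis using Suc d qr(2) by blast
  qed
  then have "{commutator G a b | a b. a \<in> iter_comm G D (Q <#> R) k \<and> b \<in> Q <#> R}
      \<subseteq> {commutator G a b | a b. a \<in> iter_comm G D' R k \<and> b \<in> R}" by blast
  then show ?case by (simp add: comm_subgroup_def mono_generate)
qed

lemma iter_comm_trivial_mono:
  assumes triv: "iter_comm G A B k \<subseteq> {\<one>}" and "k \<le> m" and B: "B \<subseteq> carrier G"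
  shows "iter_comm G A B m \<subseteq> {\<one>}"
  using assms(2)
proof (induction m rule: dec_induct)
  case base
  then show ?case by (rule triv)
next
  case (step j)
  have "commutator G a b \<in> {\<one>}" if "a \<in> iter_comm G A B j" "b \<in> B" for a b
  proof -
    have "a = \<one>" "b \<in> carrier G" using that step.IH B by auto
    then show ?thesis by (simp add: commutator_eq_cj)
  qed
  then show ?case using comm_subgroup_subset[OF triv_subgroup] by simp
qed

text \<open>The fixed points of \<open>F\<close> form a subgroup, so if \<open>F\<close> fixes each
  generator \<open>[a, f]\<close>, it fixes all of \<open>[A, F]\<close>, and the next commutators
  are trivial.\<close>

lemma iter_comm_quadratic:
  assumes F: "F \<subseteq> carrier G" and A: "A \<subseteq> carrier G"
    and quad: "\<And>a f g. a \<in> A \<Longrightarrow> f \<in> F \<Longrightarrow> g \<in> F \<Longrightarrow> cj G g (commutator G a f) = commutator G a f"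
  shows "iter_comm G A F 2 \<subseteq> {\<one>}"
proof -
  have "comm_subgroup G A F \<subseteq> fixed_by G (carrier G) F"
  proof (rule comm_subgroup_subset)
    show "subgroup (fixed_by G (carrier G) F) G" using F by (rule subgroup_fixed_by[OF subgroup_self])
    fix a f assume "a \<in> A" "f \<in> F"
    then show "commutator G a f \<in> fixed_by G (carrier G) F"
      using A F quad unfolding fixed_by_def by blast
  qed
  then have "commutator G m g \<in> {\<one>}" if "m \<in> comm_subgroup G A F" "g \<in> F" for m g
    using that F unfolding fixed_by_def by (auto simp: commutator_eq_cj subset_iff)
  then have "comm_subgroup G (comm_subgroup G A F) F \<subseteq> {\<one>}"
    by (rule comm_subgroup_subset[OF triv_subgroup])
  then show ?thesis by (simp add: numeral_2_eq_2)
qed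

section \<open>The Oliver subgroup\<close>

lemma oliver_chain_one: "oliver_chain G p {\<one>}"
  unfolding oliver_chain_def
  by (rule exI[of _ 0], rule exI[of _ "\<lambda>_. {\<one>}"]) (simp add: one_is_normal)

lemma oliver_chain_extend:
  assumes K: "oliver_chain G p K" and Q: "Q \<lhd> G" "K \<subseteq> Q"
    and comm: "iter_comm G (Omega1 G p (centralizer G K)) Q (p - 1) \<subseteq> {\<one>}"
  shows "oliver_chain G p Q"
proof -
  obtain n :: nat and T where T: "\<forall>i\<le>n. T i \<lhd> G" "T 0 = {\<one>}" "T n = K"
    "\<forall>i. 1 \<le> i \<and> i \<le> n \<longrightarrow> T (i - 1) \<subseteq> T i"
    "\<forall>i. 1 \<le> i \<and> i \<le> n \<longrightarrow>
      iter_comm G (Omega1 G p (centralizer G (T (i - 1)))) (T i) (p - 1) = {\<one>}"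
    using K unfolding oliver_chain_def by (elim exE conjE) (rule that)
  \<comment> \<open>A chain demands equality with \<open>{\<one>}\<close>; the missing inclusion
    holds because every iterated commutator subgroup contains \<open>\<one>\<close>.\<close>
  have comm': "iter_comm G (Omega1 G p (centralizer G K)) Q (p - 1) = {\<one>}"
    using comm one_in_iter_comm[of "Omega1 G p (centralizer G K)"]
    unfolding Omega1_def by (blast intro: generate.one)
  \<comment> \<open>\<open>Q\<close> is appended as term \<open>Suc n\<close>. The value stays
    \<open>Q\<close> beyond that index, so normality holds for all \<open>i\<close>.\<close>
  define T' where "T' i = (if i \<le> n then T i else Q)" for i
  show ?thesis unfolding oliver_chain_def
  proof (intro exI conjI allI impI)
    show "T' 0 = {\<one>}" "T' (Suc n) = Q" using T(2) by (simp_all add: T'_def)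
    show "T' i \<lhd> G" for i using T(1) Q(1) by (simp add: T'_def)
    fix i assume i: "1 \<le> i \<and> i \<le> Suc n"
    show "T' (i - 1) \<subseteq> T' i"
      using T(3) T(4)[THEN spec, of i] i Q(2) by (cases "i = Suc n") (auto simp: T'_def)
    show "iter_comm G (Omega1 G p (centralizer G (T' (i - 1)))) (T' i) (p - 1) = {\<one>}"
      using T(3) T(5)[THEN spec, of i] i comm' by (cases "i = Suc n") (auto simp: T'_def)
  qed
qed

text \<open>\<open>K\<close> acts trivially on \<open>\<Omega>\<^sub>1(C(K Q\<^sub>i))\<close>, so multiplying the chain \<open>Q\<^sub>i\<close> of \<open>L\<close> by \<open>K\<close> continues the
  chain of \<open>K\<close>.\<close>

lemma oliver_chain_set_mult:
  assumes K: "oliver_chain G p K" "K \<lhd> G" and L: "oliver_chain G p L"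
  shows "oliver_chain G p (K <#> L)"
proof -
  obtain n :: nat and T where T: "\<forall>i\<le>n. T i \<lhd> G" "T 0 = {\<one>}" "T n = L"
    "\<forall>i. 1 \<le> i \<and> i \<le> n \<longrightarrow> T (i - 1) \<subseteq> T i"
    "\<forall>i. 1 \<le> i \<and> i \<le> n \<longrightarrow>
      iter_comm G (Omega1 G p (centralizer G (T (i - 1)))) (T i) (p - 1) = {\<one>}"
    using L unfolding oliver_chain_def by (elim exE conjE) (rule that)
  have sg: "subgroup K G" using K(2) by (rule normal_imp_subgroup)
  have Kc: "K \<subseteq> carrier G" using sg by (rule subgroup.subset)
  have "i \<le> n \<Longrightarrow> oliver_chain G p (K <#> T i)" for i
  proof (induction i)
    case 0
    have "K <#> {\<one>} = K" using Kc by (simp flip: r_coset_eq_set_mult)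
    then show ?case using K T(2) by simp
  next
    case (Suc i)
    have N: "T i \<lhd> G" "T (Suc i) \<lhd> G" using T(1) Suc.prems by auto
    have sgT: "subgroup (T i) G" using N(1) by (rule normal_imp_subgroup)
    let ?D = "Omega1 G p (centralizer G (K <#> T i))"
    have KT: "K <#> T i \<lhd> G" using K(2) N(1) by (rule normal_set_mult_normal)
    have CD: "?D \<subseteq> centralizer G (K <#> T i)"
      by (rule Omega1_subset[OF normal_imp_subgroup[OF centralizer_normal[OF KT]]])
    have "iter_comm G ?D (K <#> T (Suc i)) (p - 1)
        \<subseteq> iter_comm G (Omega1 G p (centralizer G (T i))) (T (Suc i)) (p - 1)"
    proof (rule iter_comm_set_mult)
      show "?D \<lhd> G" by (rule Omega1_normal[OF centralizer_normal[OF KT]])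
      show "?D \<subseteq> Omega1 G p (centralizer G (T i))"
        by (rule Omega1_mono[OF centralizer_antimono[OF subset_set_mult(2)[OF sg sgT]]])
      show "?D \<subseteq> centralizer G K"
        using CD centralizer_antimono[OF subset_set_mult(1)[OF sg sgT]] by (rule subset_trans)
      show "T (Suc i) \<subseteq> carrier G" using normal_imp_subgroup[OF N(2)] by (rule subgroup.subset)
    qed (rule Kc)
    also have "\<dots> = {\<one>}" using T(5)[THEN spec, of "Suc i"] Suc.prems by simp
    finally have "iter_comm G ?D (K <#> T (Suc i)) (p - 1) \<subseteq> {\<one>}" .
    moreover have "K <#> T i \<subseteq> K <#> T (Suc i)"
      using T(4)[THEN spec, of "Suc i"] Suc.prems by (simp add: mono_set_mult)
    moreover have "oliver_chain G p (K <#> T i)" using Suc by simp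
    ultimately show ?case
      using oliver_chain_extend normal_set_mult_normal[OF K(2) N(2)] by blast
  qed
  then show ?thesis using T(3) by blast
qed

text \<open>Justifies the definite description in \<open>oliver\<close>. Let \<open>K\<close> be a
  normal subgroup of greatest order that ends a chain. For any other such \<open>L\<close> the
  product \<open>K <#> L\<close> ends a chain too, so it equals \<open>K\<close>, and
  \<open>L \<subseteq> K\<close>.\<close>

lemma oliver_greatest:
  assumes fin: "finite (carrier G)"
  shows "oliver G p \<lhd> G" "oliver_chain G p (oliver G p)"
    and "\<And>K. K \<lhd> G \<Longrightarrow> oliver_chain G p K \<Longrightarrow> K \<subseteq> oliver G p"
proof -
  let ?P = "\<lambda>K. K \<lhd> G \<and> oliver_chain G p K"
  have sub: "K \<subseteq> carrier G" if "K \<lhd> G" for K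
    using normal_imp_subgroup[OF that] by (rule subgroup.subset)
  have "?P {\<one>}" using one_is_normal oliver_chain_one by blast
  moreover have "\<forall>K. ?P K \<longrightarrow> card K < Suc (card (carrier G))"
    using sub card_mono[OF fin] by (auto simp: less_Suc_eq_le)
  ultimately obtain K where K: "?P K" and max: "\<And>L. ?P L \<Longrightarrow> card L \<le> card K"
    using ex_has_greatest_nat[of ?P "{\<one>}" card "Suc (card (carrier G))"] by blast
  have great: "L \<subseteq> K" if L: "?P L" for L
  proof -
    have KL: "?P (K <#> L)"
      using K L oliver_chain_set_mult normal_set_mult_normal by blast
    have inc: "K \<subseteq> K <#> L" "L \<subseteq> K <#> L"
      using subset_set_mult K L normal_imp_subgroup by blast+
    have "finite (K <#> L)" using sub[of "K <#> L"] KL fin finite_subset by blast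
    then have "K = K <#> L" using inc(1) max[OF KL] by (rule card_seteq)
    then show ?thesis using inc(2) by simp
  qed
  have "oliver G p = K" unfolding oliver_def
  proof (rule the_equality)
    show "K \<lhd> G \<and> oliver_chain G p K \<and> (\<forall>K'. K' \<lhd> G \<and> oliver_chain G p K' \<longrightarrow> K' \<subseteq> K)"
      using K great by blast
    fix L assume "L \<lhd> G \<and> oliver_chain G p L \<and> (\<forall>K'. K' \<lhd> G \<and> oliver_chain G p K' \<longrightarrow> K' \<subseteq> L)"
    then show "L = K" using K great by blast
  qed
  then show "oliver G p \<lhd> G" "oliver_chain G p (oliver G p)"
    "\<And>K. K \<lhd> G \<Longrightarrow> oliver_chain G p K \<Longrightarrow> K \<subseteq> oliver G p"
    using K great by blast+
qed

text \<open>The maximality of \<open>oliver G p\<close> in usable form. As \<open>?X\<close>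
  centralizes \<open>?W\<close>, the iterated commutators of \<open>?W\<close> with
  \<open>?X <#> F\<close> are bounded by those with \<open>F\<close>. The latter vanish from the
  second on, and \<open>p \<ge> 3\<close> gives \<open>2 \<le> p - 1\<close>.\<close>

lemma subset_oliver_if_quadratic:
  assumes fin: "finite (carrier G)" and p: "p \<ge> 3" and F: "subgroup F G"
    and central: "\<And>f s. f \<in> F \<Longrightarrow> s \<in> carrier G \<Longrightarrow> commutator G f s \<in> oliver G p"
    and quad: "\<And>w f g. w \<in> Omega1 G p (centralizer G (oliver G p)) \<Longrightarrow> f \<in> F \<Longrightarrow> g \<in> F \<Longrightarrow>
      cj G g (commutator G w f) = commutator G w f"
  shows "F \<subseteq> oliver G p"
proof -
  let ?X = "oliver G p"
  let ?W = "Omega1 G p (centralizer G ?X)"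
  note X = oliver_greatest[OF fin]
  have sgX: "subgroup ?X G" using X(1) by (rule normal_imp_subgroup)
  have Fc: "f \<in> carrier G" if "f \<in> F" for f by (rule subgroup.mem_carrier[OF F that])
  have N: "?X <#> F \<lhd> G"
  proof (rule normal_set_mult[OF X(1) F])
    fix f g assume f: "f \<in> F" and g: "g \<in> carrier G"
    \<comment> \<open>Rewrites \<open>f^g = f [f, g]\<close> with the factor from \<open>?X\<close>
      on the left, to match \<open>?X <#> F\<close>.\<close>
    have "cj G g f = cj G (inv f) (commutator G f g) \<otimes> f"
      using Fc[OF f] g by (simp add: cj_eq_mult_commutator[of f g] cj_def[of G "inv f"] m_assoc)
    moreover have "cj G (inv f) (commutator G f g) \<in> ?X"
      using normal_cj_closed[OF X(1)] Fc[OF f] central[OF f g] by simp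
    ultimately show "cj G g f \<in> ?X <#> F" using f unfolding set_mult_def by blast
  qed
  have W: "?W \<lhd> G" by (rule Omega1_normal[OF centralizer_normal[OF X(1)]])
  have "iter_comm G ?W (?X <#> F) (p - 1) \<subseteq> iter_comm G ?W F (p - 1)"
  proof (rule iter_comm_set_mult[OF W])
    show "?W \<subseteq> centralizer G ?X"
      by (rule Omega1_subset[OF normal_imp_subgroup[OF centralizer_normal[OF X(1)]]])
    show "?X \<subseteq> carrier G" "F \<subseteq> carrier G" using sgX F by (auto dest: subgroup.subset)
  qed simp
  also have "\<dots> \<subseteq> {\<one>}"
  proof (rule iter_comm_trivial_mono)
    show "iter_comm G ?W F 2 \<subseteq> {\<one>}"
      using subgroup.subset[OF F] subgroup.subset[OF normal_imp_subgroup[OF W]] quad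
      by (rule iter_comm_quadratic)
    show "2 \<le> p - 1" using p by simp
    show "F \<subseteq> carrier G" using F by (rule subgroup.subset)
  qed
  finally have "iter_comm G ?W (?X <#> F) (p - 1) \<subseteq> {\<one>}" .
  then have "oliver_chain G p (?X <#> F)"
    by (rule oliver_chain_extend[OF X(2) N subset_set_mult(1)[OF sgX F]])
  then have "?X <#> F \<subseteq> ?X" using X(3)[OF N] by blast
  then show ?thesis using subset_set_mult(2)[OF sgX F] by blast
qed

text \<open>The part of \<open>D\<close> that is central modulo \<open>N\<close>. Closure rests on
  \<open>[x^-1, s] = ([x, s]^-1)^(x^-1)\<close> and
  \<open>[x y, s] = [x, s]^y [y, s]\<close>.\<close>

lemma subgroup_central_mod:
  assumes N: "N \<lhd> G" and D: "subgroup D G"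
  shows "subgroup {d \<in> D. \<forall>s\<in>carrier G. commutator G d s \<in> N} G"
proof (rule subgroupI)
  let ?F = "{d \<in> D. \<forall>s\<in>carrier G. commutator G d s \<in> N}"
  have sg: "subgroup N G" using N by (rule normal_imp_subgroup)
  have Dc: "d \<in> carrier G" if "d \<in> D" for d by (rule subgroup.mem_carrier[OF D that])
  show "?F \<subseteq> carrier G" using Dc by blast
  have "\<one> \<in> ?F"
    using subgroup.one_closed[OF D] subgroup.one_closed[OF sg] by (simp add: commutator_eq_cj)
  then show "?F \<noteq> {}" by blast
  fix x assume x: "x \<in> ?F"
  have xc: "x \<in> carrier G" using x Dc by blast
  have "commutator G (inv x) s \<in> N" if s: "s \<in> carrier G" for s
  proof -
    have "commutator G (inv x) s = cj G (inv x) (inv (commutator G x s))"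
      using xc s by (simp add: commutator_def cj_def inv_mult_group m_assoc)
    moreover have "inv (commutator G x s) \<in> N"
      using x s subgroup.m_inv_closed[OF sg] by blast
    ultimately show ?thesis using normal_cj_closed[OF N] xc by simp
  qed
  then show "inv x \<in> ?F" using x subgroup.m_inv_closed[OF D] by blast
  fix y assume y: "y \<in> ?F"
  have yc: "y \<in> carrier G" using y Dc by blast
  have "commutator G (x \<otimes> y) s \<in> N" if s: "s \<in> carrier G" for s
  proof -
    have "commutator G (x \<otimes> y) s = cj G y (commutator G x s) \<otimes> commutator G y s"
      using xc yc s by (simp add: commutator_def cj_def inv_mult_group m_assoc inv_mult_cancel)
    moreover have "cj G y (commutator G x s) \<in> N" using normal_cj_closed[OF N yc] x s by blast
    ultimately show ?thesis using y s subgroup.m_closed[OF sg] by auto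
  qed
  then show "x \<otimes> y \<in> ?F" using x y subgroup.m_closed[OF D] by blast
qed

text \<open>Let \<open>?F\<close> be the part of \<open>?D\<close> that is central modulo
  \<open>?X\<close>. For \<open>w\<close> in \<open>Omega1 G p ?D\<close> and \<open>f\<close> in
  \<open>?F\<close> the commutator \<open>[w, f]\<close> lies in \<open>?X\<close>, which
  \<open>?F\<close> centralizes. So \<open>?F\<close> acts quadratically and is contained in
  \<open>?X\<close>.\<close>

lemma centralizer_oliver_subset:
  assumes ord: "order G = p ^ n" "Factorial_Ring.prime (p::nat)" and p: "p \<ge> 3"
  shows "centralizer G (oliver G p) \<subseteq> oliver G p"
proof (rule ccontr)
  let ?X = "oliver G p"
  let ?D = "centralizer G ?X"
  assume not: "\<not> ?D \<subseteq> ?X"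
  have fin: "finite (carrier G)"
    using ord prime_gt_0_nat[OF ord(2)] by (simp flip: order_gt_0_iff_finite)
  note X = oliver_greatest[OF fin]
  have sgX: "subgroup ?X G" using X(1) by (rule normal_imp_subgroup)
  have D: "?D \<lhd> G" by (rule centralizer_normal[OF X(1)])
  have sgD: "subgroup ?D G" using D by (rule normal_imp_subgroup)
  \<comment> \<open>The whole group acts on the cosets of \<open>?D \<inter> ?X\<close> in
    \<open>?D\<close>. A second fixed coset gives an element of \<open>?F\<close> outside
    \<open>?X\<close>.\<close>
  have "\<exists>c\<in>?D - ?D \<inter> ?X. \<forall>a\<in>carrier G. commutator G c a \<in> ?D \<inter> ?X"
  proof (rule ex_commutators_in_subgroup[OF subgroup_self _ sgD _ ord])
    show "subgroup (?D \<inter> ?X) G" using sgD sgX by (rule subgroups_Inter_pair)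
    show "?D \<inter> ?X \<subset> ?D" using not by blast
    fix a x assume a: "a \<in> carrier G"
    show "cj G a x \<in> ?D" if "x \<in> ?D" using D a that by (rule normal_cj_closed)
    show "cj G a x \<in> ?D \<inter> ?X" if "x \<in> ?D \<inter> ?X"
      using normal_cj_closed[OF D a] normal_cj_closed[OF X(1) a] that by blast
  qed
  then obtain c where c: "c \<in> ?D" "c \<notin> ?X" "\<forall>a\<in>carrier G. commutator G c a \<in> ?X" by blast
  let ?F = "{d \<in> ?D. \<forall>s\<in>carrier G. commutator G d s \<in> ?X}"
  have "?F \<subseteq> ?X"
  proof (rule subset_oliver_if_quadratic[OF fin p subgroup_central_mod[OF X(1) sgD]])
    show "commutator G f s \<in> ?X" if "f \<in> ?F" "s \<in> carrier G" for f s using that by blast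
    fix w f g assume w: "w \<in> Omega1 G p ?D" and f: "f \<in> ?F" and g: "g \<in> ?F"
    have wc: "w \<in> carrier G"
      using w Omega1_subset[OF sgD] subgroup.mem_carrier[OF sgD] by blast
    have fc: "f \<in> carrier G" and gc: "g \<in> carrier G"
      using f g subgroup.mem_carrier[OF sgD] by blast+
    have "commutator G f w \<in> ?X" using f wc by blast
    then have "inv (commutator G f w) \<in> ?X" using sgX by (rule subgroup.m_inv_closed[rotated])
    then have "commutator G w f \<in> ?X" using inv_commutator[OF fc wc] by simp
    then have "g \<otimes> commutator G w f = commutator G w f \<otimes> g"
      using g centralizer_commute by blast
    then show "cj G g (commutator G w f) = commutator G w f"
      using cj_eq_iff[OF gc commutator_closed[OF wc fc]] by simp
  qed
  then show False using c by blast
qed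

section \<open>Elementary abelian subgroups and the preimage of the center\<close>

lemma elementary_abelian_Omega1:
  assumes D: "subgroup D G" and comm: "\<And>x y. x \<in> D \<Longrightarrow> y \<in> D \<Longrightarrow> x \<otimes> y = y \<otimes> x"
  shows "elementary_abelian G p (Omega1 G p D)"
  unfolding elementary_abelian_def
proof (intro conjI ballI)
  have Dc: "d \<in> carrier G" if "d \<in> D" for d by (rule subgroup.mem_carrier[OF D that])
  show "subgroup (Omega1 G p D) G"
    unfolding Omega1_def using Dc by (intro generate_is_subgroup) blast
  have sub: "Omega1 G p D \<subseteq> D" using D by (rule Omega1_subset)
  show "x \<otimes> y = y \<otimes> x" if "x \<in> Omega1 G p D" "y \<in> Omega1 G p D" for x y
    using comm sub that by blast
  \<comment> \<open>In an abelian group the solutions of \<open>x^p = 1\<close> form a subgroup, and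
    it contains the generators of \<open>Omega1 G p D\<close>.\<close>
  let ?T = "{x \<in> D. x [^] p = \<one>}"
  have "subgroup ?T G"
  proof (rule subgroupI)
    show "?T \<subseteq> carrier G" using Dc by blast
    show "?T \<noteq> {}" using subgroup.one_closed[OF D] by force
    fix x assume x: "x \<in> ?T"
    then show "inv x \<in> ?T"
      using Dc subgroup.m_inv_closed[OF D] by (simp add: nat_pow_inv)
    fix y assume "y \<in> ?T"
    then show "x \<otimes> y \<in> ?T"
      using x Dc subgroup.m_closed[OF D] pow_mult_distrib[OF comm] by simp
  qed
  moreover have "{x \<in> D. ord x = p} \<subseteq> ?T"
    using Dc pow_ord_eq_1 by blast
  ultimately have "Omega1 G p D \<subseteq> ?T"
    unfolding Omega1_def by (rule generate_subgroup_incl[rotated])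
  then show "x [^] p = \<one>" if "x \<in> Omega1 G p D" for x using that by blast
qed

lemma elementary_abelian_set_mult:
  assumes N: "elementary_abelian G p N" "N \<lhd> G" and K: "elementary_abelian G p K"
    and comm: "\<And>x y. x \<in> N \<Longrightarrow> y \<in> K \<Longrightarrow> x \<otimes> y = y \<otimes> x"
  shows "elementary_abelian G p (N <#> K)"
  unfolding elementary_abelian_def
proof (intro conjI ballI)
  have sgN: "subgroup N G" and sgK: "subgroup K G"
    using N K unfolding elementary_abelian_def by auto
  have Nc: "x \<in> carrier G" if "x \<in> N" for x by (rule subgroup.mem_carrier[OF sgN that])
  have Kc: "x \<in> carrier G" if "x \<in> K" for x by (rule subgroup.mem_carrier[OF sgK that])
  interpret second_isomorphism_grp N G K
    using N(2) sgK by (intro second_isomorphism_grp.intro second_isomorphism_grp_axioms.intro)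
  show "subgroup (N <#> K) G" by (rule normal_set_mult_subgroup)
  fix x assume "x \<in> N <#> K"
  then obtain a b where x: "a \<in> N" "b \<in> K" "x = a \<otimes> b" unfolding set_mult_def by blast
  have pows: "a [^] p = \<one>" "b [^] p = \<one>"
    using N K x unfolding elementary_abelian_def by auto
  then show "x [^] p = \<one>"
    using x Nc Kc comm pow_mult_distrib[OF comm[OF x(1,2)]] by simp
  fix y assume "y \<in> N <#> K"
  then obtain c d where y: "c \<in> N" "d \<in> K" "y = c \<otimes> d" unfolding set_mult_def by blast
  have car: "a \<in> carrier G" "b \<in> carrier G" "c \<in> carrier G" "d \<in> carrier G"
    using x y Nc Kc by auto
  have ac: "a \<otimes> c = c \<otimes> a" and bd: "b \<otimes> d = d \<otimes> b"
    using N K x y unfolding elementary_abelian_def by auto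
  have "x \<otimes> y = a \<otimes> (b \<otimes> c) \<otimes> d" using x y car by (simp add: m_assoc)
  also have "\<dots> = (a \<otimes> c) \<otimes> (b \<otimes> d)"
    unfolding comm[OF y(1) x(2), symmetric] using car by (simp add: m_assoc)
  also have "\<dots> = c \<otimes> (a \<otimes> d) \<otimes> b" unfolding ac bd using car by (simp add: m_assoc)
  also have "\<dots> = y \<otimes> x" unfolding comm[OF x(1) y(2)] using x y car by (simp add: m_assoc)
  finally show "x \<otimes> y = y \<otimes> x" .
qed

text \<open>Turns ranks into orders. Elementary abelian subgroups have order a power of
  \<open>p\<close>, so \<open>elab_rank\<close> is well defined, and the set of ranks is finite, so
  its \<open>Max\<close> is an upper bound.\<close>

lemma card_le_if_max_rank:
  assumes ord: "order G = p ^ n" "Factorial_Ring.prime (p::nat)"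
    and E: "elementary_abelian G p E" "elab_rank p E = p_rank G p"
    and A: "elementary_abelian G p A"
  shows "card A \<le> card E"
proof -
  have p: "p > 1" using ord(2) by (rule prime_gt_1_nat)
  have card: "card B = p ^ elab_rank p B" if B: "elementary_abelian G p B" for B
  proof -
    obtain k where k: "card B = p ^ k"
      using subgroup_card_prime_power[OF _ ord] B unfolding elementary_abelian_def by blast
    have "elab_rank p B = k"
      unfolding elab_rank_def using k p by (intro the_equality) auto
    then show ?thesis using k by simp
  qed
  have fin: "finite (carrier G)"
    using ord prime_gt_0_nat[OF ord(2)] by (simp flip: order_gt_0_iff_finite)
  have "{elab_rank p B | B. elementary_abelian G p B} \<subseteq> elab_rank p ` Pow (carrier G)"
    unfolding elementary_abelian_def by (auto dest: subgroup.subset)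
  then have "finite {elab_rank p B | B. elementary_abelian G p B}"
    using fin finite_subset by blast
  then have "elab_rank p A \<le> p_rank G p"
    unfolding p_rank_def using A by (intro Max_ge) auto
  then show ?thesis using card[OF A] card[OF E(1)] E(2) p by (simp add: power_increasing)
qed

text \<open>\<open>e s\<close> and \<open>s e\<close> lie in the same coset, so
  \<open>e s = x s e\<close> with \<open>x\<close> in the Oliver subgroup; then
  \<open>[e, s] = (s e)^-1 (e s)\<close> is the conjugate \<open>x^(s e)\<close>.\<close>

lemma oliver1_commutator:
  assumes X: "oliver G p \<lhd> G" and e: "e \<in> oliver1 G p" and s: "s \<in> carrier G"
  shows "commutator G e s \<in> oliver G p"
proof -
  let ?X = "oliver G p"
  interpret normal ?X G by (rule X)
  have ec: "e \<in> carrier G" and "?X #> e \<in> center (G Mod ?X)"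
    using e unfolding oliver1_def by auto
  moreover have "?X #> s \<in> carrier (G Mod ?X)" using s by (simp add: carrier_FactGroup)
  ultimately have "(?X #> e) <#> (?X #> s) = (?X #> s) <#> (?X #> e)"
    unfolding center_def centralizer_def by simp
  then have eq: "?X #> (e \<otimes> s) = ?X #> (s \<otimes> e)" using ec s by (simp add: rcos_sum)
  have "e \<otimes> s \<in> ?X #> (e \<otimes> s)" using ec s by (intro rcos_self subgroup_axioms) auto
  then obtain x where x: "x \<in> ?X" "e \<otimes> s = x \<otimes> (s \<otimes> e)"
    unfolding eq by (auto simp: r_coset_def)
  have "commutator G e s = inv (s \<otimes> e) \<otimes> (e \<otimes> s)"
    using ec s by (simp add: commutator_def inv_mult_group m_assoc)
  also have "\<dots> = cj G (s \<otimes> e) x" unfolding x(2) using ec s mem_carrier[OF x(1)]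
    by (simp add: cj_def m_assoc)
  also have "\<dots> \<in> ?X" using normal_cj_closed[OF X _ x(1)] ec s by simp
  finally show ?thesis .
qed

end

section \<open>Elementary abelian subgroups of maximal rank inside \<open>oliver1\<close>\<close>

theorem theorem1p2:
  fixes S :: "('a, 'b) monoid_scheme" and p :: nat and E :: "'a set"
  assumes "p_group S p"
    and "odd p"
    and "elementary_abelian S p E"
    and "elab_rank p E = p_rank S p"
    and "E \<subseteq> oliver1 S p"
  shows "E \<subseteq> oliver S p"
proof -
  interpret group S using assms(1) unfolding p_group_def by blast
  obtain n where ord: "order S = p ^ n" "Factorial_Ring.prime p" and fin: "finite (carrier S)"
    using assms(1) unfolding p_group_def order_def by blast
  have p: "p \<ge> 3" using assms(2) prime_ge_2_nat[OF ord(2)] by (cases "p = 2") auto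
  let ?X = "oliver S p"
  let ?D = "centralizer S ?X"
  let ?W = "Omega1 S p ?D"
  note X = oliver_greatest[OF fin, where p = p]
  have D: "?D \<lhd> S" by (rule centralizer_normal[OF X(1)])
  have sgD: "subgroup ?D S" using D by (rule normal_imp_subgroup)
  have DX: "?D \<subseteq> ?X" by (rule centralizer_oliver_subset[OF ord p])
  \<comment> \<open>Elements of \<open>?D\<close> commute with \<open>?X\<close>, hence with each
    other, since \<open>?D\<close> is contained in \<open>?X\<close>.\<close>
  have D_comm: "x \<otimes>\<^bsub>S\<^esub> y = y \<otimes>\<^bsub>S\<^esub> x" if "x \<in> ?D" "y \<in> ?D" for x y
    using centralizer_commute[OF that(1)] that(2) DX by blast
  have W: "?W \<lhd> S" by (rule Omega1_normal[OF D])
  have WD: "?W \<subseteq> ?D" using sgD by (rule Omega1_subset)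
  have elabW: "elementary_abelian S p ?W" by (rule elementary_abelian_Omega1[OF sgD D_comm])
  have sgW: "subgroup ?W S" using W by (rule normal_imp_subgroup)
  have W_comm: "x \<otimes>\<^bsub>S\<^esub> y = y \<otimes>\<^bsub>S\<^esub> x" if "x \<in> ?W" "y \<in> ?W" for x y
    using D_comm that WD by blast
  have sgE: "subgroup E S" and E_comm: "\<And>x y. x \<in> E \<Longrightarrow> y \<in> E \<Longrightarrow> x \<otimes>\<^bsub>S\<^esub> y = y \<otimes>\<^bsub>S\<^esub> x"
    using assms(3) unfolding elementary_abelian_def by auto
  have Ec: "e \<in> carrier S" if "e \<in> E" for e by (rule subgroup.mem_carrier[OF sgE that])
  have Wc: "w \<in> carrier S" if "w \<in> ?W" for w by (rule subgroup.mem_carrier[OF sgW that])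
  have finE: "finite E" and finW: "finite ?W"
    using finite_subset[OF subgroup.subset[OF sgE] fin] finite_subset[OF subgroup.subset[OF sgW] fin]
    by simp_all
  have central: "commutator S e s \<in> ?X" if "e \<in> E" "s \<in> carrier S" for e s
    using oliver1_commutator[OF X(1)] assms(5) that by blast
  define K where "K = {e \<in> E. \<forall>w\<in>?W. cj S e w = w}"
  have K_comm: "w \<otimes>\<^bsub>S\<^esub> k = k \<otimes>\<^bsub>S\<^esub> w" if "w \<in> ?W" "k \<in> K" for w k
    using that Ec Wc cj_eq_iff[of k w] unfolding K_def by blast
  have sgK: "subgroup K S"
    unfolding K_def using sgE subgroup.subset[OF sgW] by (rule subgroup_fixing)
  have KE: "K \<subseteq> E" unfolding K_def by blast
  have elabK: "elementary_abelian S p K"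
    using assms(3) sgK KE unfolding elementary_abelian_def by blast
  have "K = E"
  proof (rule ccontr)
    assume ne: "K \<noteq> E"
    interpret act: abelian_action S ?W E
      by (intro abelian_action.intro abelian_action_axioms.intro group_axioms sgW sgE W_comm E_comm
          normal_cj_closed[OF W] Ec)
    \<comment> \<open>Maximality of the rank enters here: \<open>K\<close> centralizes
      \<open>?W\<close>, so their product is elementary abelian.\<close>
    have "card (?W <#>\<^bsub>S\<^esub> K) \<le> card E"
      using card_le_if_max_rank[OF ord assms(3,4) elementary_abelian_set_mult[OF elabW W elabK K_comm]] .
    moreover have "card (?W \<inter> K) \<le> card (fixed_by S ?W E)"
    proof (rule card_mono)
      show "finite (fixed_by S ?W E)" using finW unfolding fixed_by_def by simp
      \<comment> \<open>Elements of \<open>K\<close> lie in the abelian group \<open>E\<close> and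
        are therefore fixed by it.\<close>
      show "?W \<inter> K \<subseteq> fixed_by S ?W E"
      proof
        fix x assume x: "x \<in> ?W \<inter> K"
        then have "cj S e x = x" if "e \<in> E" for e
          using cj_eq_iff[OF Ec[OF that] Wc[of x]] E_comm[of x e] KE that by blast
        then show "x \<in> fixed_by S ?W E" using x unfolding fixed_by_def by blast
      qed
    qed
    ultimately have "card (?W <#>\<^bsub>S\<^esub> K) * card (?W \<inter> K) \<le> card E * card (fixed_by S ?W E)"
      by (rule mult_le_mono)
    then have "card K * card ?W \<le> card E * card (fixed_by S ?W E)"
      using card_set_mult_ge[OF sgW sgK finW finite_subset[OF KE finE]]
      by (simp add: mult.commute[of "card K"])
    then obtain H where H: "subgroup H S" "K \<subset> H" "H \<subseteq> E"
      "\<forall>v\<in>?W. \<forall>f\<in>H. \<forall>g\<in>H. cj S g (commutator S v f) = commutator S v f"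
      using act.ex_quadratic_subgroup[OF ord K_def ne] by blast
    have "H \<subseteq> ?X"
    proof (rule subset_oliver_if_quadratic[OF fin p H(1)])
      show "commutator S f s \<in> ?X" if "f \<in> H" "s \<in> carrier S" for f s
        using central that H(3) by blast
      show "cj S g (commutator S w f) = commutator S w f" if "w \<in> ?W" "f \<in> H" "g \<in> H" for w f g
        using H(4) that by blast
    qed
    \<comment> \<open>\<open>?W\<close> is contained in the centralizer of \<open>?X\<close>, so
      \<open>H \<subseteq> ?X\<close> acts trivially on \<open>?W\<close>. This contradicts the
      choice of \<open>H\<close> as properly larger than \<open>K\<close>.\<close>
    have "H \<subseteq> K"
    proof
      fix h assume h: "h \<in> H"
      then have hE: "h \<in> E" using H(3) by blast
      have "cj S h w = w" if w: "w \<in> ?W" for w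
        using cj_eq_iff[OF Ec[OF hE] Wc[OF w]] centralizer_commute[of w ?X h] w WD h \<open>H \<subseteq> ?X\<close>
        by blast
      then show "h \<in> K" using hE unfolding K_def by blast
    qed
    then show False using H(2) by blast
  qed
  show ?thesis
  \<comment> \<open>Since \<open>E = K\<close> centralizes \<open>?W\<close>, all commutators
    \<open>[w, f]\<close> are trivial and the quadratic criterion applies to \<open>E\<close>
    itself.\<close>
  proof (rule subset_oliver_if_quadratic[OF fin p sgE central])
    fix w f g assume w: "w \<in> ?W" and f: "f \<in> E" and g: "g \<in> E"
    have "f \<in> K" using f \<open>K = E\<close> by blast
    then have "commutator S w f = \<one>\<^bsub>S\<^esub>"
      using w Ec[OF f] Wc[OF w] unfolding K_def by (simp add: commutator_eq_cj)
    then show "cj S g (commutator S w f) = commutator S w f" using Ec[OF g] by simp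
  qed
qed

end
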